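(* Assume that conditions (C1), (C2) and (C3) stated in the context hold. Then $$\lim_{b\to\infty}\frac1b\log \mathbb{P}\left(\tau_b^*<\tau_b^0,\ \tau_b^*=\tau_b^j\right)=-r_j\quad\text{for each } j\in[J],$$ $$\lim_{b\to\infty}\frac1b\log \mathbb{P}\left(\tau_b^*<\tau_b^0\right)=-r_*,\qquad\text{where } r_*:=\min_{j\in[J]}r_j.$$ Moreover, $0<r_j<\infty$ for each $j\in[J]$.
   Context: $X_1,X_2,\ldots$ are i.i.d. $\mathbb{R}^d$-valued random vectors on a probability space $(\Omega,\mathcal{F},\mathbb{P})$, $S_0=0$, $S_n=\sum_{i=1}^nX_i$. For $\theta,x\in\mathbb{R}^d$: $\Lambda(\theta)=\log\mathbb{E}[e^{\theta\cdot X_1}]\in(-\infty,\infty]$, $\Lambda^*(x)=\sup_{\theta\in\mathbb{R}^d}\{\theta\cdot x-\Lambda(\theta)\}$, $I(x)=\sup\{\theta\cdot x:\Lambda(\theta)\le 0\}$. For a function $f$, $\operatorname{dom}(f)=\{f<\infty\}$; for $A\subset\mathbb{R}^d$, $\operatorname{cone}(A)=\{\lambda x:\lambda>0,x\in A\}$; $B(x,r)$ is the open Euclidean ball; $[J]=\{1,\ldots,J\}$. $W^1,\ldots,W^J\subset\mathbb{R}^d$ are open convex sets and $W^0\subset\mathbb{R}^d$ is an open set (not necessarily convex, possibly empty). For $b>0$, $bW=\{bx:x\in W\}$, $\tau_b^j=\inf\{n\ge0:S_n\in bW^j\}$ for $j=0,1,\ldots,J$ (with $\inf\emptyset=\infty$),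 and $\tau_b^*=\min_{j\in[J]}\tau_b^j$. For $j\in[J]$, $r_j=\inf_{x\in W^j}I(x)$. (C1) There is $\delta>0$ such that $\operatorname{cone}(B(\mathbb{E}[X_1],\delta))\cap W^j=\emptyset$ for every $j\in[J]$. (C2) $\operatorname{dom}(\Lambda)$ is open, and $\operatorname{int}(\operatorname{cone}(\operatorname{dom}(\Lambda^* )))\cap W^j\neq\emptyset$ for every $j\in[J]$. (C3) $\operatorname{cone}(W^j)\cap\operatorname{cone}(W^{j'})=\emptyset$ for all $0\le j\ne j'\le J$, and there is $\delta>0$ such that $B(\mathbf 0,\delta)\cap W^j=\emptyset$ for each $j\in\{0\}\cup[J]$. *)

theory Defs
  imports "HOL-Probability.Probability"
begin

text \<open>
  The natural logarithm on $[0,\infty]$ with $\log 0 = -\infty$ and $\log \infty = \infty$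
  (unlike \<^const>\<open>ln\<close>, which is $0$ at $0$).
\<close>
definition eln :: "ennreal \<Rightarrow> ereal" where
  "eln x = (if x = 0 then -\<infinity> else if x = \<infinity> then \<infinity> else ereal (ln (enn2real x)))"

definition pos_cone :: "'a::real_vector set \<Rightarrow> 'a set" where
  "pos_cone A = {c *\<^sub>R x | c x. 0 < c \<and> x \<in> A}"

definition eff_dom :: "('a \<Rightarrow> ereal) \<Rightarrow> 'a set" where
  "eff_dom f = {x. f x < \<infinity>}"

definition iid_seq :: "'w measure \<Rightarrow> (nat \<Rightarrow> 'w \<Rightarrow> 'v::euclidean_space) \<Rightarrow> bool" where
  "iid_seq M X \<longleftrightarrow>
     prob_space.indep_vars M (\<lambda>_. borel) X {1..} \<and>
     (\<forall>i\<ge>1. distr M borel (X i) = distr M borel (X 1))"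

definition cgf :: "'w measure \<Rightarrow> (nat \<Rightarrow> 'w \<Rightarrow> 'v::euclidean_space) \<Rightarrow> 'v \<Rightarrow> ereal" where
  "cgf M X \<theta> = eln (\<integral>\<^sup>+\<omega>. ennreal (exp (\<theta> \<bullet> X 1 \<omega>)) \<partial>M)"

definition cgf_conj :: "'w measure \<Rightarrow> (nat \<Rightarrow> 'w \<Rightarrow> 'v::euclidean_space) \<Rightarrow> 'v \<Rightarrow> ereal" where
  "cgf_conj M X x = (SUP \<theta>. ereal (\<theta> \<bullet> x) - cgf M X \<theta>)"

definition rate :: "'w measure \<Rightarrow> (nat \<Rightarrow> 'w \<Rightarrow> 'v::euclidean_space) \<Rightarrow> 'v \<Rightarrow> ereal" where
  "rate M X x = (SUP \<theta>\<in>{\<theta>. cgf M X \<theta> \<le> 0}. ereal (\<theta> \<bullet> x))"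

definition min_rate ::
  "'w measure \<Rightarrow> (nat \<Rightarrow> 'w \<Rightarrow> 'v::euclidean_space) \<Rightarrow> 'v set \<Rightarrow> ereal" where
  "min_rate M X A = (INF x\<in>A. rate M X x)"

definition walk :: "(nat \<Rightarrow> 'w \<Rightarrow> 'v::euclidean_space) \<Rightarrow> nat \<Rightarrow> 'w \<Rightarrow> 'v" where
  "walk X n \<omega> = (\<Sum>i=1..n. X i \<omega>)"

text \<open>In \<^typ>\<open>enat\<close>, the infimum of the empty set is $\infty$.\<close>
definition hit :: "(nat \<Rightarrow> 'w \<Rightarrow> 'v::euclidean_space) \<Rightarrow> 'v set \<Rightarrow> real \<Rightarrow> 'w \<Rightarrow> enat" where
  "hit X A b \<omega> = Inf {enat n | n. walk X n \<omega> \<in> (*\<^sub>R) b ` A}"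

definition first_hit ::
  "(nat \<Rightarrow> 'w \<Rightarrow> 'v::euclidean_space) \<Rightarrow> (nat \<Rightarrow> 'v set) \<Rightarrow> nat \<Rightarrow> real \<Rightarrow> 'w \<Rightarrow> enat" where
  "first_hit X W J b \<omega> = Min ((\<lambda>j. hit X (W j) b \<omega>) ` {1..J})"

text \<open>
  The Bochner integral of a non-integrable function is $0$; under \<open>C2\<close> below, $X_1$ is
  integrable, since \<open>cgf\<close> is $0$ at $0$ and hence finite on a neighbourhood of $0$.
\<close>
definition C1 ::
  "'w measure \<Rightarrow> (nat \<Rightarrow> 'w \<Rightarrow> 'v::euclidean_space) \<Rightarrow> (nat \<Rightarrow> 'v set) \<Rightarrow> nat \<Rightarrow> bool" where
  "C1 M X W J \<longleftrightarrow>
     (\<exists>\<delta>>0. \<forall>j\<in>{1..J}. pos_cone (ball (\<integral>\<omega>. X 1 \<omega> \<partial>M) \<delta>) \<inter> W j = {})"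

definition C2 ::
  "'w measure \<Rightarrow> (nat \<Rightarrow> 'w \<Rightarrow> 'v::euclidean_space) \<Rightarrow> (nat \<Rightarrow> 'v set) \<Rightarrow> nat \<Rightarrow> bool" where
  "C2 M X W J \<longleftrightarrow>
     open (eff_dom (cgf M X)) \<and>
     (\<forall>j\<in>{1..J}. interior (pos_cone (eff_dom (cgf_conj M X))) \<inter> W j \<noteq> {})"

definition C3 :: "(nat \<Rightarrow> 'v::euclidean_space set) \<Rightarrow> nat \<Rightarrow> bool" where
  "C3 W J \<longleftrightarrow>
     (\<forall>j\<in>{0..J}. \<forall>j'\<in>{0..J}. j \<noteq> j' \<longrightarrow> pos_cone (W j) \<inter> pos_cone (W j') = {}) \<and>
     (\<exists>\<delta>>0. \<forall>j\<in>{0..J}. ball 0 \<delta> \<inter> W j = {})"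

end

theory Submission
  imports Defs
begin

text \<open>
  Let \<open>K = {\<theta>. E (exp (\<theta> \<bullet> X 1)) \<le> 1}\<close>, a closed convex set whose support function is the rate
  function. Upper bound: by convex duality some \<open>\<theta> \<in> K\<close> satisfies \<open>\<theta> \<bullet> x \<ge> r j\<close> on \<open>W j\<close>, and
  \<open>C1\<close> provides \<open>\<theta>0\<close> in the interior of \<open>K\<close> that is nonnegative on \<open>W j\<close>. Moving \<open>\<theta>\<close> slightly
  towards \<open>\<theta>0\<close> and summing the Chernoff bounds over all times gives a convergent geometric series.
  Lower bound: choose \<open>x \<in> W j\<close> interior to the domain of the rate function with nearly minimal
  rate. The maximiser \<open>\<theta>\<close> of \<open>\<theta> \<bullet> x\<close> over \<open>K\<close> lies on the boundary, and \<open>x\<close> is a positive multiple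
  of the gradient there, which is the mean of \<open>X 1\<close> under the law tilted by \<open>\<theta>\<close>. Under the tilted
  law the walk follows the segment from \<open>0\<close> to \<open>b x\<close> with high probability, at cost
  \<open>exp (- b (\<theta> \<bullet> x))\<close>, and by \<open>C3\<close> such a path enters no other target before \<open>W j\<close>.
\<close>

section \<open>Moment generating function in place of its logarithm\<close>

text \<open>For the rate function and for the domain only finiteness and the sign of
  \<open>cgf\<close> matter; working with the exponential moment in \<open>ennreal\<close> avoids
  the logarithm and its infinite values.\<close>

definition mgf :: "'w measure \<Rightarrow> (nat \<Rightarrow> 'w \<Rightarrow> 'v::euclidean_space) \<Rightarrow> 'v \<Rightarrow> ennreal" where
  "mgf M X \<theta> = (\<integral>\<^sup>+\<omega>. ennreal (exp (\<theta> \<bullet> X 1 \<omega>)) \<partial>M)"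

lemma eln_le_0_iff: "eln x \<le> 0 \<longleftrightarrow> x \<le> 1"
proof (cases x)
  case (real r)
  then show ?thesis
    by (cases "r = 0") (auto simp: eln_def ennreal_le_1 zero_ereal_def ennreal_eq_0_iff)
qed (auto simp: eln_def top_unique)

lemma eln_less_top_iff: "eln x < \<infinity> \<longleftrightarrow> x < \<infinity>"
  by (auto simp: eln_def less_top top.not_eq_extremum)

lemma cgf_le_0_iff: "cgf M X \<theta> \<le> 0 \<longleftrightarrow> mgf M X \<theta> \<le> 1"
  by (simp add: cgf_def mgf_def eln_le_0_iff)

lemma eff_dom_cgf: "eff_dom (cgf M X) = {\<theta>. mgf M X \<theta> < \<infinity>}"
  unfolding eff_dom_def cgf_def mgf_def eln_less_top_iff ..

section \<open>Difference quotients of the exponential\<close>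

text \<open>Convexity of \<open>exp\<close> on the segment from \<open>0\<close> to
  \<open>t0 * y\<close>. The slope at \<open>t0\<close> thus bounds all slopes at smaller
  \<open>t\<close>.\<close>

lemma exp_slope_le:
  fixes y t t0 :: real
  assumes "0 < t" "t \<le> t0"
  shows "(exp (t * y) - 1) / t \<le> (exp (t0 * y) - 1) / t0"
proof -
  have "exp ((1 - t / t0) *\<^sub>R 0 + (t / t0) *\<^sub>R (t0 * y)) \<le> (1 - t / t0) * exp 0 + (t / t0) * exp (t0 * y)"
    using assms by (intro convex_onD[OF exp_convex]) auto
  then have "exp (t * y) - 1 \<le> t * ((exp (t0 * y) - 1) / t0)"
    using assms by (simp add: algebra_simps diff_divide_distrib)
  then show ?thesis
    using assms by (simp add: pos_divide_le_eq mult.commute)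
qed

lemma exp_slope_ge:
  fixes y t :: real
  assumes "0 < t"
  shows "y \<le> (exp (t * y) - 1) / t"
  using assms exp_ge_add_one_self[of "t * y"] by (simp add: pos_le_divide_eq mult.commute[of y] le_diff_eq add.commute)

text \<open>The limit is taken along the sequence \<open>t0 / Suc n\<close> so that dominated
  convergence for sequences applies.\<close>

lemma exp_slope_tendsto: "((\<lambda>n. (exp (t0 / real (Suc n) * y) - 1) / (t0 / real (Suc n))) \<longlonglongrightarrow> y)"
  if "0 < t0" for t0 y :: real
proof -
  have "((\<lambda>t. exp (t * y)) has_real_derivative y) (at 0)"
    by (auto intro!: derivative_eq_intros)
  then have "((\<lambda>t. (exp (t * y) - 1) / t) \<longlongrightarrow> y) (at 0)"
    by (simp add: has_field_derivative_iff)
  moreover have "(\<lambda>n. t0 / real (Suc n)) \<longlonglongrightarrow> 0"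
    using tendsto_mult_right_zero[OF LIMSEQ_inverse_real_of_nat, of t0] by (simp add: divide_inverse)
  then have "filterlim (\<lambda>n. t0 / real (Suc n)) (at 0) sequentially"
    using that by (auto simp: filterlim_at intro!: always_eventually)
  ultimately show ?thesis
    by (rule filterlim_compose)
qed

text \<open>
  The slopes \<open>(exp (t * Y) - 1) / t\<close> decrease to \<open>Y\<close> as \<open>t\<close> decreases to \<open>0\<close>.
\<close>
lemma exp_integral_decreases:
  fixes w Y :: "'w \<Rightarrow> real"
  assumes "0 < t0" and w: "\<And>\<omega>. 0 \<le> w \<omega>"
    and iw: "integrable M w" and iY: "integrable M (\<lambda>\<omega>. w \<omega> * Y \<omega>)"
    and ie: "integrable M (\<lambda>\<omega>. w \<omega> * exp (t0 * Y \<omega>))"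
    and meas [measurable]: "w \<in> borel_measurable M" "Y \<in> borel_measurable M"
    and neg: "(\<integral>\<omega>. w \<omega> * Y \<omega> \<partial>M) < 0"
  shows "\<exists>t. 0 < t \<and> t \<le> t0 \<and> integrable M (\<lambda>\<omega>. w \<omega> * exp (t * Y \<omega>)) \<and>
    (\<integral>\<omega>. w \<omega> * exp (t * Y \<omega>) \<partial>M) < (\<integral>\<omega>. w \<omega> \<partial>M)"
proof -
  define t where "t n = t0 / real (Suc n)" for n
  have t: "0 < t n" "t n \<le> t0" for n
    using \<open>0 < t0\<close> by (auto simp: t_def field_simps)
  define f where "f n \<omega> = w \<omega> * ((exp (t n * Y \<omega>) - 1) / t n)" for n \<omega>
  \<comment> \<open>Integrable majorant of all \<open>f n\<close>: they lie between
    \<open>w * Y\<close> and the weighted slope at \<open>t0\<close>.\<close>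
  define g where "g \<omega> = \<bar>w \<omega> * Y \<omega>\<bar> + (w \<omega> * exp (t0 * Y \<omega>) + w \<omega>) / t0" for \<omega>
  have ig: "integrable M g"
    unfolding g_def using iw iY ie by (intro Bochner_Integration.integrable_add integrable_abs integrable_divide)
  have f_meas [measurable]: "f n \<in> borel_measurable M" for n
    unfolding f_def by measurable
  have bound: "norm (f n \<omega>) \<le> g \<omega>" for n \<omega>
  proof -
    have "w \<omega> * Y \<omega> \<le> f n \<omega>"
      unfolding f_def using exp_slope_ge[OF t(1)] w by (intro mult_left_mono)
    moreover have "f n \<omega> \<le> w \<omega> * ((exp (t0 * Y \<omega>) - 1) / t0)"
      unfolding f_def using exp_slope_le[OF t(1) t(2)] w by (intro mult_left_mono)
    moreover have "w \<omega> * ((exp (t0 * Y \<omega>) - 1) / t0) \<le> (w \<omega> * exp (t0 * Y \<omega>) + w \<omega>) / t0"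
      using \<open>0 < t0\<close> w[of \<omega>] by (simp add: field_simps)
    moreover have "0 \<le> (w \<omega> * exp (t0 * Y \<omega>) + w \<omega>) / t0"
      using \<open>0 < t0\<close> w[of \<omega>] by simp
    ultimately show ?thesis
      unfolding g_def by auto
  qed
  have "(\<lambda>n. integral\<^sup>L M (f n)) \<longlonglongrightarrow> (\<integral>\<omega>. w \<omega> * Y \<omega> \<partial>M)"
  proof (rule integral_dominated_convergence[OF _ _ ig])
    show "AE \<omega> in M. (\<lambda>n. f n \<omega>) \<longlonglongrightarrow> w \<omega> * Y \<omega>"
      unfolding f_def t_def using exp_slope_tendsto[OF \<open>0 < t0\<close>] by (intro always_eventually allI tendsto_mult_left)
  qed (use bound in auto)
  then have "\<forall>\<^sub>F n in sequentially. integral\<^sup>L M (f n) < 0"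
    using neg by (rule order_tendstoD(2))
  then obtain n where n: "integral\<^sup>L M (f n) < 0"
    by (auto simp: eventually_sequentially)
  have if_: "integrable M (f n)"
    by (rule Bochner_Integration.integrable_bound[OF ig]) (use bound in \<open>auto intro: order_trans[OF _ abs_ge_self]\<close>)
  have eq: "(\<lambda>\<omega>. w \<omega> * exp (t n * Y \<omega>)) = (\<lambda>\<omega>. w \<omega> + t n * f n \<omega>)"
    using less_imp_neq[OF t(1)[of n]] by (simp add: f_def fun_eq_iff algebra_simps diff_divide_distrib)
  have "integrable M (\<lambda>\<omega>. w \<omega> * exp (t n * Y \<omega>))"
    unfolding eq using iw if_ by auto
  moreover have "(\<integral>\<omega>. w \<omega> * exp (t n * Y \<omega>) \<partial>M) = (\<integral>\<omega>. w \<omega> \<partial>M) + t n * integral\<^sup>L M (f n)"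
    unfolding eq using iw if_ by (subst Bochner_Integration.integral_add) auto
  moreover have "t n * integral\<^sup>L M (f n) < 0"
    using t(1) n by (rule mult_pos_neg)
  ultimately show ?thesis
    using t by (intro exI[of _ "t n"]) auto
qed

lemma convex_pos_cone:
  assumes "convex A"
  shows "convex (pos_cone A)"
proof (rule convexI)
  fix x y and u v :: real
  assume "x \<in> pos_cone A" "y \<in> pos_cone A" and uv: "0 \<le> u" "0 \<le> v" "u + v = 1"
  then obtain c a d b where x: "x = c *\<^sub>R a" "0 < c" "a \<in> A" and y: "y = d *\<^sub>R b" "0 < d" "b \<in> A"
    unfolding pos_cone_def by auto
  \<comment> \<open>Dividing by the total scale \<open>s\<close> turns \<open>u * c\<close> and
    \<open>v * d\<close> into convex weights for \<open>a\<close> and \<open>b\<close>.\<close>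
  define s where "s = u * c + v * d"
  have "0 < s"
    unfolding s_def using uv x(2) y(2)
    by (cases "u = 0") (auto intro: add_pos_nonneg)
  have "(u * c / s) *\<^sub>R a + (v * d / s) *\<^sub>R b \<in> A"
    using assms x y uv \<open>0 < s\<close> by (intro convexD) (auto simp: s_def simp flip: add_divide_distrib)
  moreover have "u *\<^sub>R x + v *\<^sub>R y = s *\<^sub>R ((u * c / s) *\<^sub>R a + (v * d / s) *\<^sub>R b)"
    using \<open>0 < s\<close> by (simp add: x y scaleR_add_right)
  ultimately show "u *\<^sub>R x + v *\<^sub>R y \<in> pos_cone A"
    unfolding pos_cone_def using \<open>0 < s\<close> by blast
qed

section \<open>Exponential moments of the walk: product formulas, convexity, closed sublevel
  set\<close>

locale iid_walk = prob_space M for M :: "'w measure" +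
  fixes X :: "nat \<Rightarrow> 'w \<Rightarrow> 'v::euclidean_space"
  assumes iid: "iid_seq M X"
begin

lemma indep: "indep_vars (\<lambda>_. borel) X {1..}"
  using iid by (simp add: iid_seq_def)

lemma X_measurable: "1 \<le> i \<Longrightarrow> X i \<in> borel_measurable M"
  using indep by (auto simp: indep_vars_def)

lemma X1_measurable [measurable]: "X 1 \<in> borel_measurable M" "X (Suc 0) \<in> borel_measurable M"
  using X_measurable[of 1] by simp_all

lemma walk_measurable [measurable]: "walk X n \<in> borel_measurable M"
  unfolding walk_def by (intro borel_measurable_sum X_measurable) auto

lemma mgf_distr: "1 \<le> i \<Longrightarrow> (\<integral>\<^sup>+\<omega>. ennreal (exp (\<theta> \<bullet> X i \<omega>)) \<partial>M) = mgf M X \<theta>"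
proof -
  assume i: "1 \<le> i"
  have *: "(\<integral>\<^sup>+\<omega>. ennreal (exp (\<theta> \<bullet> X k \<omega>)) \<partial>M) = (\<integral>\<^sup>+x. ennreal (exp (\<theta> \<bullet> x)) \<partial>distr M borel (X k))"
    if "1 \<le> k" for k
    using X_measurable[OF that] by (subst nn_integral_distr) auto
  have "distr M borel (X i) = distr M borel (X 1)"
    using iid i unfolding iid_seq_def by blast
  then show ?thesis
    unfolding mgf_def *[OF i] using *[of 1] by simp
qed

text \<open>Each step may carry its own exponent \<open>a i\<close>, which covers one time and two
  times of the walk alike.\<close>

lemma mgf_prod:
  "(\<integral>\<^sup>+\<omega>. ennreal (exp (\<Sum>i=1..n. a i \<bullet> X i \<omega>)) \<partial>M) = (\<Prod>i=1..n. mgf M X (a i))"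
proof -
  have "(\<integral>\<^sup>+\<omega>. ennreal (exp (\<Sum>i=1..n. a i \<bullet> X i \<omega>)) \<partial>M) =
    (\<integral>\<^sup>+\<omega>. (\<Prod>i=1..n. ennreal (exp (a i \<bullet> X i \<omega>))) \<partial>M)"
    by (simp add: exp_sum prod_ennreal)
  also have "\<dots> = (\<Prod>i=1..n. \<integral>\<^sup>+\<omega>. ennreal (exp (a i \<bullet> X i \<omega>)) \<partial>M)"
    by (intro indep_vars_nn_integral indep_vars_compose2[OF indep_vars_subset[OF indep]]) auto
  also have "\<dots> = (\<Prod>i=1..n. mgf M X (a i))"
    by (intro prod.cong refl mgf_distr) auto
  finally show ?thesis .
qed

lemma mgf_walk: "(\<integral>\<^sup>+\<omega>. ennreal (exp (\<theta> \<bullet> walk X n \<omega>)) \<partial>M) = mgf M X \<theta> ^ n"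
  using mgf_prod[of "\<lambda>_. \<theta>" n] by (simp add: walk_def inner_sum_right)

text \<open>The first \<open>k\<close> steps carry the exponent \<open>\<theta> + u\<close> and the
  others \<open>\<theta>\<close>. If \<open>mgf M X \<theta> = 1\<close>, this is the moment
  generating function at \<open>u\<close> of the walk at time \<open>k\<close> under the tilted
  law.\<close>

lemma mgf_walk_two:
  assumes "k \<le> n"
  shows "(\<integral>\<^sup>+\<omega>. ennreal (exp (\<theta> \<bullet> walk X n \<omega> + u \<bullet> walk X k \<omega>)) \<partial>M) =
    mgf M X (\<theta> + u) ^ k * mgf M X \<theta> ^ (n - k)"
proof -
  let ?a = "\<lambda>i. if i \<le> k then \<theta> + u else \<theta>"
  have split: "{1..n} = {1..k} \<union> {k<..n}"
    using assms by auto
  have "(\<Sum>i=1..n. ?a i \<bullet> X i \<omega>) = \<theta> \<bullet> walk X n \<omega> + u \<bullet> walk X k \<omega>" for \<omega>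
    unfolding walk_def inner_sum_right split
    by (subst (1 2) sum.union_disjoint) (auto simp: inner_add_left sum.distrib)
  moreover have "(\<Prod>i=1..n. mgf M X (?a i)) = mgf M X (\<theta> + u) ^ k * mgf M X \<theta> ^ (n - k)"
    unfolding split by (subst prod.union_disjoint) auto
  ultimately show ?thesis
    using mgf_prod[of ?a n] by simp
qed

lemma mgf_0 [simp]: "mgf M X 0 = 1"
  by (simp add: mgf_def emeasure_space_1)

lemma mgf_convex:
  assumes "0 \<le> s" "s \<le> 1"
  shows "mgf M X ((1 - s) *\<^sub>R \<theta> + s *\<^sub>R \<theta>') \<le> ennreal (1 - s) * mgf M X \<theta> + ennreal s * mgf M X \<theta>'"
proof -
  have "mgf M X ((1 - s) *\<^sub>R \<theta> + s *\<^sub>R \<theta>') \<le>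
    (\<integral>\<^sup>+\<omega>. ennreal (1 - s) * ennreal (exp (\<theta> \<bullet> X 1 \<omega>)) + ennreal s * ennreal (exp (\<theta>' \<bullet> X 1 \<omega>)) \<partial>M)"
    unfolding mgf_def
  proof (intro nn_integral_mono)
    fix \<omega>
    have "exp ((1 - s) *\<^sub>R (\<theta> \<bullet> X 1 \<omega>) + s *\<^sub>R (\<theta>' \<bullet> X 1 \<omega>)) \<le>
      (1 - s) * exp (\<theta> \<bullet> X 1 \<omega>) + s * exp (\<theta>' \<bullet> X 1 \<omega>)"
      using assms by (intro convex_onD[OF exp_convex]) auto
    then show "ennreal (exp (((1 - s) *\<^sub>R \<theta> + s *\<^sub>R \<theta>') \<bullet> X 1 \<omega>)) \<le>
      ennreal (1 - s) * ennreal (exp (\<theta> \<bullet> X 1 \<omega>)) + ennreal s * ennreal (exp (\<theta>' \<bullet> X 1 \<omega>))"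
      using assms by (simp add: inner_add_left ennreal_leI flip: ennreal_mult ennreal_plus)
  qed
  also have "\<dots> = ennreal (1 - s) * mgf M X \<theta> + ennreal s * mgf M X \<theta>'"
    unfolding mgf_def by (simp add: nn_integral_add nn_integral_cmult)
  finally show ?thesis .
qed

lemma convex_mgf_le_1: "convex {\<theta>. mgf M X \<theta> \<le> 1}"
proof (rule convexI)
  fix \<theta> \<theta>' u v assume *: "\<theta> \<in> {\<theta>. mgf M X \<theta> \<le> 1}" "\<theta>' \<in> {\<theta>. mgf M X \<theta> \<le> 1}"
    and uv: "0 \<le> u" "0 \<le> v" "u + v = (1::real)"
  have u: "1 - v = u"
    using uv by simp
  have "mgf M X (u *\<^sub>R \<theta> + v *\<^sub>R \<theta>') \<le> ennreal u * mgf M X \<theta> + ennreal v * mgf M X \<theta>'"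
    using mgf_convex[of v \<theta> \<theta>'] uv by (simp add: u)
  also have "\<dots> \<le> ennreal u * 1 + ennreal v * 1"
    using * by (intro add_mono mult_left_mono) auto
  also have "\<dots> = 1"
    using uv by (simp flip: ennreal_plus)
  finally show "u *\<^sub>R \<theta> + v *\<^sub>R \<theta>' \<in> {\<theta>. mgf M X \<theta> \<le> 1}"
    by simp
qed

text \<open>Fatou's lemma gives lower semicontinuity of \<open>mgf\<close>, which suffices even
  where \<open>mgf\<close> is infinite.\<close>

lemma closed_mgf_le_1: "closed {\<theta>. mgf M X \<theta> \<le> 1}"
  unfolding closed_sequential_limits
proof (intro allI impI, elim conjE)
  fix f \<theta> assume f: "\<forall>n. f n \<in> {\<theta>. mgf M X \<theta> \<le> 1}" and lim: "f \<longlonglongrightarrow> \<theta>"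
  have "(\<lambda>n. ennreal (exp (f n \<bullet> X 1 \<omega>))) \<longlonglongrightarrow> ennreal (exp (\<theta> \<bullet> X 1 \<omega>))" for \<omega>
    by (intro tendsto_intros lim)
  then have "mgf M X \<theta> = (\<integral>\<^sup>+\<omega>. liminf (\<lambda>n. ennreal (exp (f n \<bullet> X 1 \<omega>))) \<partial>M)"
    unfolding mgf_def by (intro nn_integral_cong) (metis lim_imp_Liminf trivial_limit_sequentially)
  also have "\<dots> \<le> liminf (\<lambda>n. mgf M X (f n))"
    unfolding mgf_def by (intro nn_integral_liminf) auto
  also have "\<dots> \<le> limsup (\<lambda>n. mgf M X (f n))"
    by (intro Liminf_le_Limsup) auto
  also have "\<dots> \<le> 1"
    using f by (intro Limsup_bounded) auto
  finally show "\<theta> \<in> {\<theta>. mgf M X \<theta> \<le> 1}"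
    by simp
qed

end

section \<open>Directional derivatives of the moment generating function on an open domain\<close>

lemma (in iid_walk) integrable_exp:
  assumes "mgf M X \<theta> < \<infinity>"
  shows "integrable M (\<lambda>\<omega>. exp (\<theta> \<bullet> X 1 \<omega>))"
  using assms by (intro integrableI_nonneg) (auto simp: mgf_def)

lemma (in iid_walk) mgf_eq_integral:
  assumes "mgf M X \<theta> < \<infinity>"
  shows "mgf M X \<theta> = ennreal (\<integral>\<omega>. exp (\<theta> \<bullet> X 1 \<omega>) \<partial>M)"
  unfolding mgf_def using integrable_exp[OF assms] by (intro nn_integral_eq_integral) auto

locale iid_walk_open = iid_walk M X
  for M :: "'w measure" and X :: "nat \<Rightarrow> 'w \<Rightarrow> 'v::euclidean_space" +
  assumes open_dom: "open {\<theta>. mgf M X \<theta> < \<infinity>}"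
begin

lemma mgf_finite_nearby:
  assumes "mgf M X \<theta> < \<infinity>"
  shows "\<exists>h>0. mgf M X (\<theta> + h *\<^sub>R u) < \<infinity> \<and> mgf M X (\<theta> - h *\<^sub>R u) < \<infinity>"
proof -
  obtain e where e: "0 < e" "\<And>\<theta>'. dist \<theta>' \<theta> < e \<Longrightarrow> mgf M X \<theta>' < \<infinity>"
    using open_dom assms unfolding open_dist by (metis mem_Collect_eq)
  \<comment> \<open>The \<open>+ 1\<close> in the denominator covers \<open>u = 0\<close>.\<close>
  define h where "h = e / (norm u + 1)"
  have "0 < norm u + 1"
    using norm_ge_zero[of u] by linarith
  then have h: "0 < h" "h * norm u < e"
    using e(1) by (auto simp: h_def field_simps)
  then show ?thesis
    using e(2) by (intro exI[of _ h]) (auto simp: dist_norm)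
qed

text \<open>Convexity replaces continuity: on a segment from \<open>\<theta>\<close> to a point with
  finite \<open>mgf\<close>, the chord stays below \<open>1\<close> for a while.\<close>

lemma mgf_le_1_nearby:
  assumes "mgf M X \<theta> < 1"
  shows "\<exists>h>0. mgf M X (\<theta> + h *\<^sub>R u) \<le> 1"
proof -
  have "mgf M X \<theta> < \<infinity>"
    using assms by (rule less_trans) simp
  then obtain h where h: "0 < h" "mgf M X (\<theta> + h *\<^sub>R u) < \<infinity>"
    using mgf_finite_nearby by blast
  obtain m where m: "0 \<le> m" "mgf M X \<theta> = ennreal m" "m < 1"
    using assms by (cases "mgf M X \<theta>") (auto simp: ennreal_less_one_iff)
  obtain k where k: "0 \<le> k" "mgf M X (\<theta> + h *\<^sub>R u) = ennreal k"
    using h(2) by (cases "mgf M X (\<theta> + h *\<^sub>R u)") auto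
  \<comment> \<open>Chosen such that \<open>s * (1 - m + k) = 1 - m\<close>, hence
    \<open>s * k \<le> 1 - m\<close> and the chord value \<open>(1 - s) * m + s * k\<close> is at
    most \<open>1\<close>.\<close>
  define s where "s = (1 - m) / (1 - m + k)"
  have pos: "0 < 1 - m + k"
    using m(3) k(1) by linarith
  then have "s * (1 - m + k) = 1 - m"
    by (simp add: s_def)
  moreover have s: "0 < s" "s \<le> 1"
    using m(3) k(1) pos by (auto simp: s_def)
  moreover have "0 \<le> s * (1 - m)"
    using s m(3) by (intro mult_nonneg_nonneg) auto
  ultimately have sk: "s * k \<le> 1 - m"
    by (simp add: distrib_left)
  have "mgf M X ((1 - s) *\<^sub>R \<theta> + s *\<^sub>R (\<theta> + h *\<^sub>R u)) \<le> ennreal (1 - s) * ennreal m + ennreal s * ennreal k"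
    using mgf_convex[of s \<theta> "\<theta> + h *\<^sub>R u"] s by (simp add: m k)
  also have "\<dots> = ennreal ((1 - s) * m + s * k)"
    using s m k by (simp flip: ennreal_mult ennreal_plus)
  also have "\<dots> \<le> ennreal 1"
  proof (intro ennreal_leI)
    have "(1 - s) * m \<le> 1 * m"
      using s m by (intro mult_right_mono) auto
    then show "(1 - s) * m + s * k \<le> 1"
      using sk by linarith
  qed
  finally have "mgf M X (\<theta> + (s * h) *\<^sub>R u) \<le> 1"
    by (simp add: algebra_simps)
  then show ?thesis
    using s h(1) by (intro exI[of _ "s * h"]) simp
qed

text \<open>With \<open>y = u \<bullet> X 1 \<omega>\<close>, the estimate
  \<open>h * \<bar>y\<bar> \<le> exp (h * y) + exp (- (h * y))\<close> absorbs the linear factor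
  into exponential moments at \<open>\<theta> + h *\<^sub>R u\<close> and
  \<open>\<theta> - h *\<^sub>R u\<close>.\<close>

lemma integrable_exp_inner:
  assumes "mgf M X \<theta> < \<infinity>"
  shows "integrable M (\<lambda>\<omega>. exp (\<theta> \<bullet> X 1 \<omega>) * (u \<bullet> X 1 \<omega>))"
proof -
  obtain h where h: "0 < h" "mgf M X (\<theta> + h *\<^sub>R u) < \<infinity>" "mgf M X (\<theta> - h *\<^sub>R u) < \<infinity>"
    using mgf_finite_nearby[OF assms] by blast
  show ?thesis
  proof (rule Bochner_Integration.integrable_bound)
    show "integrable M (\<lambda>\<omega>. (exp ((\<theta> + h *\<^sub>R u) \<bullet> X 1 \<omega>) + exp ((\<theta> - h *\<^sub>R u) \<bullet> X 1 \<omega>)) / h)"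
      using h by (intro integrable_divide Bochner_Integration.integrable_add integrable_exp)
    show "AE \<omega> in M. norm (exp (\<theta> \<bullet> X 1 \<omega>) * (u \<bullet> X 1 \<omega>)) \<le>
      norm ((exp ((\<theta> + h *\<^sub>R u) \<bullet> X 1 \<omega>) + exp ((\<theta> - h *\<^sub>R u) \<bullet> X 1 \<omega>)) / h)"
    proof (rule AE_I2)
      fix \<omega>
      let ?y = "u \<bullet> X 1 \<omega>"
      have "h * \<bar>?y\<bar> \<le> exp (h * ?y) + exp (- (h * ?y))"
        using exp_ge_add_one_self[of "h * ?y"] exp_ge_add_one_self[of "- (h * ?y)"]
          exp_gt_zero[of "h * ?y"] exp_gt_zero[of "- (h * ?y)"] abs_mult[of h ?y] h(1)
        by linarith
      then have "exp (\<theta> \<bullet> X 1 \<omega>) * (h * \<bar>?y\<bar>) \<le> exp (\<theta> \<bullet> X 1 \<omega>) * (exp (h * ?y) + exp (- (h * ?y)))"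
        by (intro mult_left_mono) auto
      also have "\<dots> = exp ((\<theta> + h *\<^sub>R u) \<bullet> X 1 \<omega>) + exp ((\<theta> - h *\<^sub>R u) \<bullet> X 1 \<omega>)"
        by (simp only: inner_add_left inner_diff_left inner_scaleR_left exp_add exp_diff exp_minus distrib_left divide_inverse)
      finally have "exp (\<theta> \<bullet> X 1 \<omega>) * \<bar>?y\<bar> \<le>
          (exp ((\<theta> + h *\<^sub>R u) \<bullet> X 1 \<omega>) + exp ((\<theta> - h *\<^sub>R u) \<bullet> X 1 \<omega>)) / h"
        using h(1) by (simp add: pos_le_divide_eq mult_ac)
      then show "norm (exp (\<theta> \<bullet> X 1 \<omega>) * ?y) \<le>
        norm ((exp ((\<theta> + h *\<^sub>R u) \<bullet> X 1 \<omega>) + exp ((\<theta> - h *\<^sub>R u) \<bullet> X 1 \<omega>)) / h)"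
        by (simp only: real_norm_def abs_mult abs_exp_cancel)
    qed
  qed simp
qed

text \<open>The gradient of \<open>mgf\<close>, differentiated under the integral. At
  \<open>0\<close> it is the mean of \<open>X 1\<close>, and where
  \<open>mgf M X \<theta> = 1\<close> it is the mean under the law tilted by
  \<open>\<theta>\<close>.\<close>

definition grad :: "'v \<Rightarrow> 'v" where
  "grad \<theta> = (\<integral>\<omega>. exp (\<theta> \<bullet> X 1 \<omega>) *\<^sub>R X 1 \<omega> \<partial>M)"

lemma integrable_exp_scaleR:
  assumes "mgf M X \<theta> < \<infinity>"
  shows "integrable M (\<lambda>\<omega>. exp (\<theta> \<bullet> X 1 \<omega>) *\<^sub>R X 1 \<omega>)"
proof -
  have "exp (\<theta> \<bullet> X 1 \<omega>) *\<^sub>R X 1 \<omega> = (\<Sum>b\<in>Basis. (exp (\<theta> \<bullet> X 1 \<omega>) * (b \<bullet> X 1 \<omega>)) *\<^sub>R b)" for \<omega>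
    by (subst (2) euclidean_representation[symmetric]) (simp add: scaleR_sum_right inner_commute)
  then show ?thesis
    using integrable_exp_inner[OF assms] by (simp only:) auto
qed

lemma inner_grad:
  assumes "mgf M X \<theta> < \<infinity>"
  shows "u \<bullet> grad \<theta> = (\<integral>\<omega>. exp (\<theta> \<bullet> X 1 \<omega>) * (u \<bullet> X 1 \<omega>) \<partial>M)"
  unfolding grad_def using integrable_exp_scaleR[OF assms]
  by (subst integral_inner_right[symmetric]) auto

text \<open>The directional derivative of \<open>mgf\<close> in direction \<open>u\<close> is \<open>u \<bullet> grad \<theta>\<close>.\<close>
lemma mgf_directional_decrease:
  assumes fin: "mgf M X \<theta> < \<infinity>" and less: "u \<bullet> grad \<theta> < c * enn2real (mgf M X \<theta>)"
  shows "\<exists>t>0. mgf M X (\<theta> + t *\<^sub>R u) < ennreal (exp (t * c)) * mgf M X \<theta>"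
proof -
  obtain h where h: "0 < h" "mgf M X (\<theta> + h *\<^sub>R u) < \<infinity>"
    using mgf_finite_nearby[OF fin] by blast
  define w where "w \<omega> = exp (\<theta> \<bullet> X 1 \<omega>)" for \<omega>
  \<comment> \<open>Subtracting \<open>c\<close> moves the factor \<open>exp (t * c)\<close> into
    the integrand. The value \<open>c = 0\<close> yields descent directions, and
    \<open>c = u \<bullet> g + \<eta>2\<close> yields deviation bounds for the tilted walk.\<close>
  define Y where "Y \<omega> = u \<bullet> X 1 \<omega> - c" for \<omega>
  have wY: "w \<omega> * exp (t * Y \<omega>) = exp (- (t * c)) * exp ((\<theta> + t *\<^sub>R u) \<bullet> X 1 \<omega>)" for t \<omega>
    unfolding w_def Y_def by (simp add: inner_add_left algebra_simps flip: exp_add)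
  have [measurable]: "w \<in> borel_measurable M" "Y \<in> borel_measurable M"
    unfolding w_def Y_def by measurable
  have iw: "integrable M w"
    unfolding w_def by (rule integrable_exp[OF fin])
  have w_Y: "w \<omega> * Y \<omega> = exp (\<theta> \<bullet> X 1 \<omega>) * (u \<bullet> X 1 \<omega>) - c * w \<omega>" for \<omega>
    by (simp add: w_def Y_def algebra_simps)
  have iwY: "integrable M (\<lambda>\<omega>. w \<omega> * Y \<omega>)"
    unfolding w_Y using iw integrable_exp_inner[OF fin] by (intro Bochner_Integration.integrable_diff) auto
  have mgf_w: "mgf M X \<theta> = ennreal (\<integral>\<omega>. w \<omega> \<partial>M)"
    unfolding w_def by (rule mgf_eq_integral[OF fin])
  have w0: "0 \<le> (\<integral>\<omega>. w \<omega> \<partial>M)"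
    by (intro Bochner_Integration.integral_nonneg) (simp add: w_def)
  have "(\<integral>\<omega>. w \<omega> * Y \<omega> \<partial>M) = u \<bullet> grad \<theta> - c * (\<integral>\<omega>. w \<omega> \<partial>M)"
    unfolding w_Y inner_grad[OF fin] using iw integrable_exp_inner[OF fin]
    by (subst Bochner_Integration.integral_diff) auto
  then have "(\<integral>\<omega>. w \<omega> * Y \<omega> \<partial>M) < 0"
    using less w0 by (simp add: mgf_w)
  moreover have "integrable M (\<lambda>\<omega>. w \<omega> * exp (h * Y \<omega>))"
    unfolding wY using integrable_exp[OF h(2)] by (intro integrable_mult_right) auto
  ultimately obtain t where t: "0 < t" "integrable M (\<lambda>\<omega>. w \<omega> * exp (t * Y \<omega>))"
      "(\<integral>\<omega>. w \<omega> * exp (t * Y \<omega>) \<partial>M) < (\<integral>\<omega>. w \<omega> \<partial>M)"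
    using exp_integral_decreases[OF h(1) _ iw iwY] by (auto simp: w_def)
  have "mgf M X (\<theta> + t *\<^sub>R u) = (\<integral>\<^sup>+\<omega>. ennreal (exp (t * c)) * ennreal (w \<omega> * exp (t * Y \<omega>)) \<partial>M)"
    unfolding mgf_def wY
    by (intro nn_integral_cong) (simp add: exp_minus flip: ennreal_mult)
  also have "\<dots> = ennreal (exp (t * c)) * ennreal (\<integral>\<omega>. w \<omega> * exp (t * Y \<omega>) \<partial>M)"
    using t(2) by (subst nn_integral_cmult) (auto intro!: arg_cong2[where f="(*)"] nn_integral_eq_integral simp: w_def)
  also have "\<dots> < ennreal (exp (t * c)) * mgf M X \<theta>"
  proof -
    have "0 \<le> (\<integral>\<omega>. w \<omega> * exp (t * Y \<omega>) \<partial>M)"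
      by (intro Bochner_Integration.integral_nonneg) (simp add: w_def)
    then show ?thesis
      unfolding mgf_w using t(3) w0 by (simp add: ennreal_less_iff flip: ennreal_mult)
  qed
  finally show ?thesis
    using t(1) by blast
qed

text \<open>First-order convexity inequality, obtained by integrating
  \<open>exp y \<ge> 1 + y\<close> for
  \<open>y = (\<theta>0 - \<theta>) \<bullet> X 1 \<omega>\<close> against the tilting weight. It
  shows that the gradient does not vanish at \<open>\<theta>\<close>.\<close>

lemma grad_inner_diff_less:
  assumes "mgf M X \<theta> = 1" "mgf M X \<theta>0 < 1"
  shows "grad \<theta> \<bullet> (\<theta>0 - \<theta>) < 0"
proof -
  have fin: "mgf M X \<theta> < \<infinity>" "mgf M X \<theta>0 < \<infinity>"
    using assms by (auto intro: less_trans)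
  have "(\<integral>\<omega>. exp (\<theta> \<bullet> X 1 \<omega>) + exp (\<theta> \<bullet> X 1 \<omega>) * ((\<theta>0 - \<theta>) \<bullet> X 1 \<omega>) \<partial>M) \<le> (\<integral>\<omega>. exp (\<theta>0 \<bullet> X 1 \<omega>) \<partial>M)"
  proof (intro integral_mono Bochner_Integration.integrable_add integrable_exp integrable_exp_inner fin)
    fix \<omega>
    have "exp (\<theta> \<bullet> X 1 \<omega>) * (1 + (\<theta>0 - \<theta>) \<bullet> X 1 \<omega>) \<le> exp (\<theta> \<bullet> X 1 \<omega>) * exp ((\<theta>0 - \<theta>) \<bullet> X 1 \<omega>)"
      by (intro mult_left_mono exp_ge_add_one_self) auto
    then show "exp (\<theta> \<bullet> X 1 \<omega>) + exp (\<theta> \<bullet> X 1 \<omega>) * ((\<theta>0 - \<theta>) \<bullet> X 1 \<omega>) \<le> exp (\<theta>0 \<bullet> X 1 \<omega>)"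
      by (simp add: inner_diff_left distrib_left flip: exp_add)
  qed
  also have "(\<integral>\<omega>. exp (\<theta> \<bullet> X 1 \<omega>) + exp (\<theta> \<bullet> X 1 \<omega>) * ((\<theta>0 - \<theta>) \<bullet> X 1 \<omega>) \<partial>M) =
      (\<integral>\<omega>. exp (\<theta> \<bullet> X 1 \<omega>) \<partial>M) + (\<theta>0 - \<theta>) \<bullet> grad \<theta>"
    unfolding inner_grad[OF fin(1)]
    by (intro Bochner_Integration.integral_add integrable_exp integrable_exp_inner fin)
  also have "(\<integral>\<omega>. exp (\<theta> \<bullet> X 1 \<omega>) \<partial>M) = 1"
    using assms(1) mgf_eq_integral[OF fin(1)] by simp
  finally have "1 + (\<theta>0 - \<theta>) \<bullet> grad \<theta> \<le> (\<integral>\<omega>. exp (\<theta>0 \<bullet> X 1 \<omega>) \<partial>M)" .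
  moreover have "(\<integral>\<omega>. exp (\<theta>0 \<bullet> X 1 \<omega>) \<partial>M) < 1"
    using assms(2) mgf_eq_integral[OF fin(2)] by (simp add: ennreal_less_iff)
  ultimately show ?thesis
    by (simp add: inner_commute)
qed

text \<open>A hyperplane separates the ball around the mean from the cone over \<open>W\<close>. Its
  normal \<open>a\<close> is nonnegative on \<open>W\<close> and negative at the mean, so
  \<open>mgf\<close> drops below \<open>mgf M X 0 = 1\<close> along a short multiple of
  \<open>a\<close>.\<close>

lemma exists_mgf_less_1:
  assumes W: "convex W" "W \<noteq> {}" and \<delta>: "0 < \<delta>"
    and disj: "pos_cone (ball (\<integral>\<omega>. X 1 \<omega> \<partial>M) \<delta>) \<inter> W = {}"
  shows "\<exists>\<theta>. mgf M X \<theta> < 1 \<and> (\<forall>x\<in>W. 0 \<le> \<theta> \<bullet> x)"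
proof -
  let ?\<mu> = "\<integral>\<omega>. X 1 \<omega> \<partial>M"
  have sub: "A \<subseteq> pos_cone A" for A :: "'v set"
    unfolding pos_cone_def by (force intro: exI[of _ 1])
  have "ball ?\<mu> \<delta> \<inter> pos_cone W = {}"
  proof (rule ccontr)
    assume "ball ?\<mu> \<delta> \<inter> pos_cone W \<noteq> {}"
    then obtain c x where cx: "0 < c" "x \<in> W" "c *\<^sub>R x \<in> ball ?\<mu> \<delta>"
      unfolding pos_cone_def by blast
    then have "x = (1 / c) *\<^sub>R (c *\<^sub>R x)" "0 < 1 / c"
      by auto
    then have "x \<in> pos_cone (ball ?\<mu> \<delta>)"
      unfolding pos_cone_def using cx(3) by blast
    then show False
      using disj cx(2) by blast
  qed
  then obtain a b where a: "a \<noteq> 0" "\<And>x. x \<in> ball ?\<mu> \<delta> \<Longrightarrow> a \<bullet> x \<le> b" "\<And>x. x \<in> pos_cone W \<Longrightarrow> b \<le> a \<bullet> x"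
    using separating_hyperplane_sets[of "ball ?\<mu> \<delta>" "pos_cone W"] W \<delta> sub[of W] convex_pos_cone
    by (metis ball_eq_empty convex_ball linorder_not_less subset_empty)
  have scale: "b \<le> c * (a \<bullet> x)" if "x \<in> W" "0 < c" for c x
    using a(3)[of "c *\<^sub>R x"] that by (auto simp: pos_cone_def)
  have nonneg: "0 \<le> a \<bullet> x" if "x \<in> W" for x
  proof (rule ccontr)
    assume "\<not> 0 \<le> a \<bullet> x"
    then have neg: "a \<bullet> x < 0" by simp
    define c where "c = (\<bar>b\<bar> + 1) / - (a \<bullet> x)"
    \<comment> \<open>A point of the ray through \<open>x\<close> whose value is below
      \<open>b\<close>.\<close>
    have "0 < c" "c * (a \<bullet> x) = - (\<bar>b\<bar> + 1)"
      using neg by (auto simp: c_def intro!: divide_pos_neg)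
    then show False
      using scale[OF that, of c] by linarith
  qed
  \<comment> \<open>The cone over \<open>W\<close> comes arbitrarily close to the origin, where the
    functional tends to \<open>0\<close>.\<close>
  have "b \<le> 0"
  proof (rule ccontr)
    assume "\<not> b \<le> 0"
    obtain x where x: "x \<in> W" using W(2) by blast
    define c where "c = b / (2 * (a \<bullet> x + 1))"
    have "0 < b * (a \<bullet> x) + b * 2"
      using \<open>\<not> b \<le> 0\<close> nonneg[OF x] by (intro add_nonneg_pos mult_nonneg_nonneg) auto
    then have "0 < c" "c * (a \<bullet> x) < b"
      using \<open>\<not> b \<le> 0\<close> nonneg[OF x] by (auto simp: c_def field_simps)
    then show False
      using scale[OF x, of c] by linarith
  qed
  have "a \<bullet> ?\<mu> < 0"
  proof -
    \<comment> \<open>A move by \<open>\<delta> / 2\<close> from the mean in direction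
      \<open>a\<close> stays in the ball and makes the inequality at the mean strict.\<close>
    define x where "x = ?\<mu> + (\<delta> / (2 * norm a)) *\<^sub>R a"
    have "x \<in> ball ?\<mu> \<delta>"
      using a(1) \<delta> by (simp add: x_def dist_norm)
    then have "a \<bullet> x \<le> 0"
      using a(2) \<open>b \<le> 0\<close> by force
    moreover have "a \<bullet> x = a \<bullet> ?\<mu> + (\<delta> / (2 * norm a)) * (a \<bullet> a)"
      by (simp add: x_def inner_add_right)
    moreover have "0 < (\<delta> / (2 * norm a)) * (a \<bullet> a)"
      using a(1) \<delta> by (intro mult_pos_pos) auto
    ultimately show ?thesis
      by linarith
  qed
  then have "a \<bullet> grad 0 < 0 * enn2real (mgf M X 0)"
    by (simp add: grad_def)
  then obtain t where t: "0 < t" "mgf M X (0 + t *\<^sub>R a) < ennreal (exp (t * 0)) * mgf M X 0"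
    using mgf_directional_decrease[of 0 a 0] by auto
  then show ?thesis
    using nonneg by (intro exI[of _ "t *\<^sub>R a"]) auto
qed

end

section \<open>Upper bound: convex duality and Chernoff bounds\<close>

lemma suminf_ennreal_geometric:
  fixes c q :: real
  assumes "0 \<le> c" "0 \<le> q" "q < 1"
  shows "(\<Sum>n. ennreal c * ennreal q ^ n) = ennreal (c / (1 - q))"
proof -
  have "(\<Sum>n. ennreal c * ennreal q ^ n) = (\<Sum>n. ennreal (c * q ^ n))"
    using assms by (simp add: ennreal_mult ennreal_power)
  also have "\<dots> = ennreal (\<Sum>n. c * q ^ n)"
    using assms by (intro suminf_ennreal2 summable_mult summable_geometric) auto
  also have "(\<Sum>n. c * q ^ n) = c / (1 - q)"
    using assms by (subst suminf_mult) (auto simp: suminf_geometric)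
  finally show ?thesis .
qed

lemma rate_le_iff: "rate M X x \<le> ereal t \<longleftrightarrow> (\<forall>\<theta>. mgf M X \<theta> \<le> 1 \<longrightarrow> \<theta> \<bullet> x \<le> t)"
  by (auto simp: rate_def SUP_le_iff cgf_le_0_iff)

context iid_walk
begin

text \<open>Since \<open>\<theta> = 0\<close> is admissible the rate is nonnegative, so this is its
  effective domain.\<close>

definition ratedom :: "'v set" where
  "ratedom = {x. \<exists>t. rate M X x \<le> ereal t}"

text \<open>
  A minimax identity, obtained by separating the epigraph of the rate function from
  \<open>W \<times> {..<r}\<close>; the point \<open>x0\<close> rules out a vertical hyperplane.
\<close>
lemma exists_exponent:
  assumes W: "convex W" and x0: "x0 \<in> W" "x0 \<in> interior ratedom"
    and r: "\<And>x. x \<in> W \<Longrightarrow> ereal r \<le> rate M X x"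
  shows "\<exists>\<theta>. mgf M X \<theta> \<le> 1 \<and> (\<forall>x\<in>W. r \<le> \<theta> \<bullet> x)"
proof -
  define E where "E = {(x, t). rate M X x \<le> ereal t}"
  have E_iff: "(x, t) \<in> E \<longleftrightarrow> (\<forall>\<theta>. mgf M X \<theta> \<le> 1 \<longrightarrow> \<theta> \<bullet> x \<le> t)" for x t
    by (simp add: E_def rate_le_iff)
  have "convex E"
  proof (rule convexI)
    fix p q and u v :: real
    assume p: "p \<in> E" and q: "q \<in> E" and uv: "0 \<le> u" "0 \<le> v" "u + v = 1"
    obtain x t y s where pq: "p = (x, t)" "q = (y, s)"
      by (cases p, cases q)
    have "\<theta> \<bullet> (u *\<^sub>R x + v *\<^sub>R y) \<le> u * t + v * s" if "mgf M X \<theta> \<le> 1" for \<theta>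
      using p q uv that unfolding pq E_iff inner_add_right inner_scaleR_right
      by (intro add_mono mult_left_mono) auto
    then show "u *\<^sub>R p + v *\<^sub>R q \<in> E"
      by (simp add: pq E_iff)
  qed
  moreover have "convex (W \<times> {..<r})"
    using W by (intro convex_Times) auto
  moreover have "(0, 0) \<in> E"
    by (simp add: E_iff)
  moreover have "(x0, r - 1) \<in> W \<times> {..<r}"
    using x0 by simp
  moreover have "E \<inter> (W \<times> {..<r}) = {}"
    using r by (auto simp: E_def) (metis ereal_less_eq(3) leD order_trans)
  ultimately obtain p b where p: "p \<noteq> 0" "\<And>z. z \<in> E \<Longrightarrow> p \<bullet> z \<le> b" "\<And>z. z \<in> W \<times> {..<r} \<Longrightarrow> b \<le> p \<bullet> z"
    using separating_hyperplane_sets[of E "W \<times> {..<r}"] by (metis empty_iff)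
  obtain \<eta> \<alpha> where p_eq: "p = (\<eta>, \<alpha>)"
    by (cases p)
  have le: "\<eta> \<bullet> x + \<alpha> * t \<le> b" if "(x, t) \<in> E" for x t
    using p(2)[OF that] by (simp add: p_eq)
  have ge: "b \<le> \<eta> \<bullet> x + \<alpha> * t" if "x \<in> W" "t < r" for x t
    using p(3)[of "(x, t)"] that by (simp add: p_eq)
  have b0: "0 \<le> b"
    using le[OF \<open>(0, 0) \<in> E\<close>] by simp
  \<comment> \<open>\<open>E\<close> is a cone, so a linear functional bounded above on
    \<open>E\<close> is nonpositive along every ray of it; this is the scalar form of that
    argument.\<close>
  have scale: "c * s \<le> 0" if "\<And>k. 0 < k \<Longrightarrow> k * (c * s) \<le> b" for c s :: real
  proof (rule ccontr)
    assume "\<not> c * s \<le> 0"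
    then have "(b + 1) / (c * s) * (c * s) \<le> b"
      using b0 by (intro that divide_pos_pos) auto
    moreover have "(b + 1) / (c * s) * (c * s) = b + 1"
      using \<open>\<not> c * s \<le> 0\<close> by (intro nonzero_eq_divide_eq[THEN iffD1]) auto
    ultimately show False
      by linarith
  qed
  have "\<alpha> * 1 \<le> 0"
  proof (rule scale)
    fix k :: real assume "0 < k"
    then have "(0, k) \<in> E"
      by (simp add: E_iff)
    from le[OF this] show "k * (\<alpha> * 1) \<le> b"
      by (simp add: mult.commute)
  qed
  \<comment> \<open>For a vertical hyperplane, \<open>\<eta>\<close> would be at most
    \<open>\<eta> \<bullet> x0\<close> on a whole ball around \<open>x0\<close>.\<close>
  moreover have "\<alpha> \<noteq> 0"
  proof
    assume \<alpha>: "\<alpha> = 0"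
    then have \<eta>: "\<eta> \<noteq> 0"
      using p(1) by (simp add: p_eq zero_prod_def)
    obtain e where e: "0 < e" "ball x0 e \<subseteq> ratedom"
      using x0(2) by (auto simp: mem_interior)
    define x where "x = x0 + (e / (2 * norm \<eta>)) *\<^sub>R \<eta>"
    have "x \<in> ball x0 e"
      using \<eta> e(1) by (simp add: x_def dist_norm)
    then obtain t where "(x, t) \<in> E"
      using e(2) by (auto simp: ratedom_def E_def)
    then have "\<eta> \<bullet> x \<le> \<eta> \<bullet> x0"
      using le ge[OF x0(1), of "r - 1"] \<alpha> by fastforce
    moreover have "\<eta> \<bullet> x = \<eta> \<bullet> x0 + (e / (2 * norm \<eta>)) * (\<eta> \<bullet> \<eta>)"
      by (simp add: x_def inner_add_right)
    moreover have "0 < (e / (2 * norm \<eta>)) * (\<eta> \<bullet> \<eta>)"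
      using \<eta> e(1) by (intro mult_pos_pos) auto
    ultimately show False
      by linarith
  qed
  ultimately have \<alpha>: "\<alpha> < 0"
    by simp
  \<comment> \<open>Normalises the hyperplane to the graph of a linear function.\<close>
  define \<theta> where "\<theta> = (1 / - \<alpha>) *\<^sub>R \<eta>"
  have \<theta>_eq: "\<eta> \<bullet> x = - \<alpha> * (\<theta> \<bullet> x)" for x
    using \<alpha> by (simp add: \<theta>_def)
  have \<theta>_le: "\<theta> \<bullet> x \<le> t" if xt: "(x, t) \<in> E" for x t
  proof -
    have "1 * (\<eta> \<bullet> x + \<alpha> * t) \<le> 0"
    proof (rule scale)
      fix k :: real assume k: "0 < k"
      have "(k *\<^sub>R x, k * t) \<in> E"
        using xt k by (auto simp: E_iff)
      from le[OF this] show "k * (1 * (\<eta> \<bullet> x + \<alpha> * t)) \<le> b"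
        by (simp add: algebra_simps)
    qed
    then have "- \<alpha> * (\<theta> \<bullet> x) \<le> - \<alpha> * t"
      by (simp add: \<theta>_eq)
    then show ?thesis
      using \<alpha> by (subst (asm) mult_le_cancel_left_pos) auto
  qed
  \<comment> \<open>The sublevel set is closed and convex, hence determined by its support function:
    strict separation of \<open>\<theta>\<close> from it gives a point \<open>(- a, - c)\<close> of
    \<open>E\<close> that violates \<open>\<theta>_le\<close>.\<close>
  have "mgf M X \<theta> \<le> 1"
  proof (rule ccontr)
    assume "\<not> mgf M X \<theta> \<le> 1"
    then obtain a c where a: "a \<bullet> \<theta> < c" "\<And>\<theta>'. mgf M X \<theta>' \<le> 1 \<Longrightarrow> c < a \<bullet> \<theta>'"
      using separating_hyperplane_closed_point[OF convex_mgf_le_1 closed_mgf_le_1, of \<theta>] by auto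
    have "(- a, - c) \<in> E"
      unfolding E_iff using a(2) by (force simp: inner_commute)
    then show False
      using \<theta>_le a(1) by (force simp: inner_commute)
  qed
  moreover have "r \<le> \<theta> \<bullet> x" if "x \<in> W" for x
  \<comment> \<open>The separation only concerns heights strictly below \<open>r\<close>.\<close>
  proof (rule dense_le)
    fix t assume "t < r"
    then have "0 \<le> \<eta> \<bullet> x + \<alpha> * t"
      using ge[OF that] b0 by force
    then have "- \<alpha> * t \<le> - \<alpha> * (\<theta> \<bullet> x)"
      by (simp add: \<theta>_eq)
    then show "t \<le> \<theta> \<bullet> x"
      using \<alpha> by (subst (asm) mult_le_cancel_left_pos) auto
  qed
  ultimately show ?thesis
    by blast
qed

text \<open>Chernoff bound: on the event, the indicator is at most
  \<open>exp (\<theta> \<bullet> walk X n \<omega> - c)\<close>.\<close>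

lemma emeasure_walk_in_halfspace:
  assumes [measurable]: "A \<in> sets borel" and A: "\<And>x. x \<in> A \<Longrightarrow> c \<le> \<theta> \<bullet> x"
  shows "emeasure M {\<omega> \<in> space M. walk X n \<omega> \<in> A} \<le> ennreal (exp (- c)) * mgf M X \<theta> ^ n"
proof -
  have "emeasure M {\<omega> \<in> space M. walk X n \<omega> \<in> A} = (\<integral>\<^sup>+\<omega>. indicator {\<omega> \<in> space M. walk X n \<omega> \<in> A} \<omega> \<partial>M)"
    by (subst nn_integral_indicator) auto
  also have "\<dots> \<le> (\<integral>\<^sup>+\<omega>. ennreal (exp (- c)) * ennreal (exp (\<theta> \<bullet> walk X n \<omega>)) \<partial>M)"
    using A by (intro nn_integral_mono)
      (auto simp: indicator_def simp flip: ennreal_mult exp_add)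
  also have "\<dots> = ennreal (exp (- c)) * mgf M X \<theta> ^ n"
    by (simp add: nn_integral_cmult mgf_walk)
  finally show ?thesis .
qed

text \<open>
  Tilting by \<open>\<theta>\<close> alone gives a divergent union bound if \<open>mgf M X \<theta> = 1\<close>; a small shift
  towards \<open>\<theta>0\<close> makes it a geometric series at an arbitrarily small cost in the exponent.
\<close>
lemma emeasure_walk_hits_le:
  assumes "open W" and \<theta>: "mgf M X \<theta> \<le> 1" "\<And>x. x \<in> W \<Longrightarrow> r \<le> \<theta> \<bullet> x"
    and \<theta>0: "mgf M X \<theta>0 < 1" "\<And>x. x \<in> W \<Longrightarrow> 0 \<le> \<theta>0 \<bullet> x"
    and "0 < r" "0 < \<epsilon>"
  shows "\<exists>C>0. \<forall>b>0. emeasure M {\<omega> \<in> space M. \<exists>n. walk X n \<omega> \<in> (*\<^sub>R) b ` W} \<le> ennreal (C * exp (- (b * (r - \<epsilon>))))"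
proof -
  \<comment> \<open>The shift costs at most \<open>s * r \<le> \<epsilon>\<close> in the exponent;
    the minimum with \<open>1\<close> keeps a convex combination.\<close>
  define s where "s = min 1 (\<epsilon> / r)"
  have s: "0 < s" "s \<le> 1" "s * r \<le> \<epsilon>"
    using \<open>0 < r\<close> \<open>0 < \<epsilon>\<close> by (auto simp: s_def min_def field_simps)
  define \<theta>1 where "\<theta>1 = (1 - s) *\<^sub>R \<theta> + s *\<^sub>R \<theta>0"
  obtain m where m: "0 \<le> m" "mgf M X \<theta>0 = ennreal m" "m < 1"
    using \<theta>0(1) by (cases "mgf M X \<theta>0") (auto simp: ennreal_less_one_iff)
  define q where "q = (1 - s) + s * m"
  have q: "0 \<le> q" "q < 1"
    using s m by (auto simp: q_def intro: add_nonneg_nonneg mult_nonneg_nonneg)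
  have "mgf M X \<theta>1 \<le> ennreal (1 - s) * mgf M X \<theta> + ennreal s * mgf M X \<theta>0"
    unfolding \<theta>1_def using s by (intro mgf_convex) auto
  also have "\<dots> \<le> ennreal (1 - s) * 1 + ennreal s * ennreal m"
    using \<theta>(1) m(2) by (intro add_mono mult_left_mono) auto
  also have "\<dots> = ennreal q"
    using s m(1) by (simp add: q_def flip: ennreal_mult ennreal_plus)
  finally have mgf_q: "mgf M X \<theta>1 \<le> ennreal q" .
  have \<theta>1: "r - \<epsilon> \<le> \<theta>1 \<bullet> x" if "x \<in> W" for x
  proof -
    have "(1 - s) * r + s * 0 \<le> (1 - s) * (\<theta> \<bullet> x) + s * (\<theta>0 \<bullet> x)"
      using s \<theta>(2)[OF that] \<theta>0(2)[OF that] by (intro add_mono mult_left_mono) auto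
    then show ?thesis
      using s(3) by (simp add: \<theta>1_def inner_add_left algebra_simps)
  qed
  have "emeasure M {\<omega> \<in> space M. \<exists>n. walk X n \<omega> \<in> (*\<^sub>R) b ` W} \<le> ennreal (1 / (1 - q) * exp (- (b * (r - \<epsilon>))))"
    if b: "0 < b" for b
  proof -
    have bW: "open ((*\<^sub>R) b ` W)"
      using b \<open>open W\<close> by (intro open_scaling) auto
    then have [measurable]: "(*\<^sub>R) b ` W \<in> sets borel"
      by simp
    have "{\<omega> \<in> space M. \<exists>n. walk X n \<omega> \<in> (*\<^sub>R) b ` W} = (\<Union>n. {\<omega> \<in> space M. walk X n \<omega> \<in> (*\<^sub>R) b ` W})"
      by auto
    then have "emeasure M {\<omega> \<in> space M. \<exists>n. walk X n \<omega> \<in> (*\<^sub>R) b ` W} \<le>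
        (\<Sum>n. emeasure M {\<omega> \<in> space M. walk X n \<omega> \<in> (*\<^sub>R) b ` W})"
      by (simp only:) (intro emeasure_subadditive_countably, auto)
    also have "\<dots> \<le> (\<Sum>n. ennreal (exp (- (b * (r - \<epsilon>)))) * ennreal q ^ n)"
    proof (intro suminf_le)
      fix n
      have "emeasure M {\<omega> \<in> space M. walk X n \<omega> \<in> (*\<^sub>R) b ` W} \<le> ennreal (exp (- (b * (r - \<epsilon>)))) * mgf M X \<theta>1 ^ n"
        using b \<theta>1 by (intro emeasure_walk_in_halfspace) auto
      also have "\<dots> \<le> ennreal (exp (- (b * (r - \<epsilon>)))) * ennreal q ^ n"
        using mgf_q by (intro mult_left_mono power_mono) auto
      finally show "emeasure M {\<omega> \<in> space M. walk X n \<omega> \<in> (*\<^sub>R) b ` W} \<le> ennreal (exp (- (b * (r - \<epsilon>)))) * ennreal q ^ n" .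
    qed auto
    also have "\<dots> = ennreal (1 / (1 - q) * exp (- (b * (r - \<epsilon>))))"
      using q by (subst suminf_ennreal_geometric) auto
    finally show ?thesis .
  qed
  then show ?thesis
    using q(2) by (intro exI[of _ "1 / (1 - q)"]) auto
qed

section \<open>Maximisers in the rate function\<close>

text \<open>Finiteness of the rate on a ball around \<open>x\<close> bounds the admissible
  \<open>\<theta>\<close> with \<open>\<theta> \<bullet> x \<ge> 0\<close> in every direction, so
  the supremum is a maximum over a compact set.\<close>

lemma rate_attained:
  assumes x: "x \<in> interior ratedom"
  shows "\<exists>\<theta>. mgf M X \<theta> \<le> 1 \<and> rate M X x = ereal (\<theta> \<bullet> x)"
proof -
  obtain e where e: "0 < e" "ball x e \<subseteq> ratedom"
    using x by (auto simp: mem_interior)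
  \<comment> \<open>The half-space discards only vectors that do worse than \<open>0\<close>, which
    lies in \<open>S\<close>.\<close>
  define S where "S = {\<theta>. mgf M X \<theta> \<le> 1} \<inter> {\<theta>. 0 \<le> x \<bullet> \<theta>}"
  have "\<exists>c. \<forall>\<theta>\<in>S. \<theta> \<bullet> u \<le> c" if u: "norm u = 1" for u
  proof -
    have "x + (e / 2) *\<^sub>R u \<in> ratedom"
      using e u by (intro subsetD[OF e(2)]) (auto simp: dist_norm)
    then obtain t where t: "\<And>\<theta>. mgf M X \<theta> \<le> 1 \<Longrightarrow> \<theta> \<bullet> (x + (e / 2) *\<^sub>R u) \<le> t"
      unfolding ratedom_def rate_le_iff by blast
    have "\<theta> \<bullet> u \<le> 2 * t / e" if "\<theta> \<in> S" for \<theta>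
    proof -
      have "\<theta> \<bullet> x + (e / 2) * (\<theta> \<bullet> u) \<le> t" "0 \<le> \<theta> \<bullet> x"
        using t[of \<theta>] that by (auto simp: S_def inner_add_right inner_commute)
      then have "(e / 2) * (\<theta> \<bullet> u) \<le> t"
        by linarith
      then show ?thesis
        using e(1) by (simp add: field_simps)
    qed
    then show ?thesis
      by blast
  qed
  then obtain c where c: "\<And>u \<theta>. norm u = 1 \<Longrightarrow> \<theta> \<in> S \<Longrightarrow> \<theta> \<bullet> u \<le> c u"
    by metis
  have "norm \<theta> \<le> (\<Sum>i\<in>Basis. \<bar>c i\<bar> + \<bar>c (- i)\<bar>)" if "\<theta> \<in> S" for \<theta>
  proof -
    have "norm \<theta> \<le> (\<Sum>i\<in>Basis. \<bar>\<theta> \<bullet> i\<bar>)"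
      by (rule norm_le_l1)
    also have "\<dots> \<le> (\<Sum>i\<in>Basis. \<bar>c i\<bar> + \<bar>c (- i)\<bar>)"
    proof (intro sum_mono)
      fix i :: 'v assume "i \<in> Basis"
      then have "\<theta> \<bullet> i \<le> c i" "\<theta> \<bullet> (- i) \<le> c (- i)"
        using c[of i \<theta>] c[of "- i" \<theta>] that by (auto simp del: inner_minus_right)
      then show "\<bar>\<theta> \<bullet> i\<bar> \<le> \<bar>c i\<bar> + \<bar>c (- i)\<bar>"
        by (auto simp: abs_le_iff)
    qed
    finally show ?thesis .
  qed
  then have "bounded S"
    by (auto simp: bounded_iff)
  moreover have "closed S"
    unfolding S_def by (intro closed_Int closed_mgf_le_1 closed_Collect_le continuous_intros)
  ultimately have "compact S"
    by (simp add: compact_eq_bounded_closed)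
  moreover have "0 \<in> S"
    by (simp add: S_def)
  ultimately obtain \<theta> where \<theta>: "\<theta> \<in> S" "\<And>\<theta>'. \<theta>' \<in> S \<Longrightarrow> \<theta>' \<bullet> x \<le> \<theta> \<bullet> x"
    using continuous_attains_sup[of S "\<lambda>\<theta>. \<theta> \<bullet> x"] by (force intro: continuous_intros)
  have max: "\<theta>' \<bullet> x \<le> \<theta> \<bullet> x" if "mgf M X \<theta>' \<le> 1" for \<theta>'
  proof (cases "\<theta>' \<in> S")
    case False
    then have "\<theta>' \<bullet> x \<le> 0" "0 \<le> \<theta> \<bullet> x"
      using that \<theta>(1) by (auto simp: S_def inner_commute)
    then show ?thesis
      by linarith
  qed (use \<theta>(2) in blast)
  have "rate M X x \<le> ereal (\<theta> \<bullet> x)"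
    using max by (simp add: rate_le_iff)
  moreover have "ereal (\<theta> \<bullet> x) \<le> rate M X x"
    unfolding rate_def using \<theta>(1) by (intro SUP_upper) (simp add: S_def cgf_le_0_iff)
  ultimately show ?thesis
    using \<theta>(1) by (intro exI[of _ \<theta>]) (simp add: S_def)
qed

end

context iid_walk_open
begin

text \<open>A Lagrange multiplier rule for maximising \<open>\<theta> \<bullet> x\<close> subject to \<open>mgf M X \<theta> \<le> 1\<close>.\<close>
lemma rate_attained_grad:
  assumes x: "x \<noteq> 0" "x \<in> interior ratedom" and \<theta>0: "mgf M X \<theta>0 < 1"
  shows "\<exists>\<theta> c. 0 < c \<and> mgf M X \<theta> = 1 \<and> x = c *\<^sub>R grad \<theta> \<and> rate M X x = ereal (\<theta> \<bullet> x)"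
proof -
  obtain \<theta> where \<theta>: "mgf M X \<theta> \<le> 1" "rate M X x = ereal (\<theta> \<bullet> x)"
    using rate_attained[OF x(2)] by blast
  have max: "\<theta>' \<bullet> x \<le> \<theta> \<bullet> x" if "mgf M X \<theta>' \<le> 1" for \<theta>'
    using \<theta>(2) that rate_le_iff[of M X x "\<theta> \<bullet> x"] by auto
  have fin: "mgf M X \<theta> < \<infinity>"
    using \<theta>(1) by (auto intro: le_less_trans)
  have no_ascent: "u \<bullet> x \<le> 0" if t: "0 < t" "mgf M X (\<theta> + t *\<^sub>R u) \<le> 1" for t u
  proof -
    have "t * (u \<bullet> x) \<le> 0"
      using max[OF t(2)] by (simp add: inner_add_left)
    then show ?thesis
      using t(1) by (simp add: mult_le_0_iff)
  qed
  have "mgf M X \<theta> = 1"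
  proof (rule ccontr)
    assume "mgf M X \<theta> \<noteq> 1"
    then have less: "mgf M X \<theta> < 1"
      using \<theta>(1) by simp
    then obtain h where "0 < h" "mgf M X (\<theta> + h *\<^sub>R x) \<le> 1"
      using mgf_le_1_nearby by blast
    then have "x \<bullet> x \<le> 0"
      by (rule no_ascent)
    then show False
      using x(1) inner_gt_zero_iff[of x] by linarith
  qed
  define g where "g = grad \<theta>"
  \<comment> \<open>A direction of strict descent of \<open>mgf\<close> stays admissible for some
    positive step, so it cannot improve the maximum.\<close>
  have desc: "u \<bullet> x \<le> 0" if "u \<bullet> g < 0" for u
  proof -
    have "u \<bullet> grad \<theta> < 0 * enn2real (mgf M X \<theta>)"
      using that by (simp add: g_def)
    then obtain t where "0 < t" "mgf M X (\<theta> + t *\<^sub>R u) < ennreal (exp (t * 0)) * mgf M X \<theta>"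
      using mgf_directional_decrease[OF fin] by blast
    then show ?thesis
      using \<open>mgf M X \<theta> = 1\<close> by (intro no_ascent[of t]) auto
  qed
  \<comment> \<open>Here \<open>\<theta>0\<close> acts as the Slater point of the constrained
    problem.\<close>
  have "g \<noteq> 0"
    using grad_inner_diff_less[OF \<open>mgf M X \<theta> = 1\<close> \<theta>0] by (auto simp: g_def)
  then have gg: "0 < g \<bullet> g"
    by simp
  \<comment> \<open>\<open>u\<close> is tilted to \<open>u - d *\<^sub>R g\<close>, where
    \<open>desc\<close> applies; \<open>d\<close> is so small that
    \<open>d * (g \<bullet> x)\<close> is at most \<open>e\<close>.\<close>
  have orth: "u \<bullet> x \<le> 0" if "u \<bullet> g = 0" for u
  proof (rule field_le_epsilon)
    fix e :: real assume "0 < e"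
    define d where "d = e / (\<bar>g \<bullet> x\<bar> + 1)"
    have "0 < d"
      using \<open>0 < e\<close> by (simp add: d_def add_nonneg_pos)
    then have "(u - d *\<^sub>R g) \<bullet> x \<le> 0"
      using that gg by (intro desc) (simp add: inner_diff_left)
    moreover have "d * (g \<bullet> x) \<le> d * (\<bar>g \<bullet> x\<bar> + 1)"
      using \<open>0 < d\<close> by (intro mult_left_mono) auto
    moreover have "d * (\<bar>g \<bullet> x\<bar> + 1) = e"
      by (simp add: d_def)
    ultimately show "u \<bullet> x \<le> 0 + e"
      by (simp add: inner_diff_left)
  qed
  \<comment> \<open>Coefficient of the orthogonal projection of \<open>x\<close> onto
    \<open>g\<close>; the remainder \<open>u\<close> vanishes because \<open>orth\<close> gives
    \<open>u \<bullet> u \<le> 0\<close>.\<close>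
  define c where "c = (x \<bullet> g) / (g \<bullet> g)"
  define u where "u = x - c *\<^sub>R g"
  have ug: "u \<bullet> g = 0"
    using gg by (simp add: u_def c_def inner_diff_left)
  have "u \<bullet> u = u \<bullet> x - c * (u \<bullet> g)"
    by (simp add: u_def inner_diff_right)
  then have "u \<bullet> u \<le> 0"
    using orth[OF ug] ug by simp
  then have "u = 0"
    using inner_gt_zero_iff[of u] by linarith
  then have xc: "x = c *\<^sub>R g"
    by (simp add: u_def)
  have "(- g) \<bullet> x \<le> 0"
    using gg by (intro desc) simp
  then have "0 \<le> c"
    using gg by (simp add: c_def inner_commute)
  then have "0 < c"
    using xc x(1) by (cases "c = 0") auto
  then show ?thesis
    using \<open>mgf M X \<theta> = 1\<close> xc \<theta>(2) unfolding g_def by blast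
qed

end

section \<open>Lower bound: the tilted walk follows a segment\<close>

text \<open>Controls a union bound over about \<open>c * b + 1\<close> times.\<close>

lemma linear_times_exp_decay:
  fixes a c :: real
  assumes "0 < a"
  shows "((\<lambda>b. (c * b + 1) * exp (- (a * b))) \<longlongrightarrow> 0) at_top"
proof -
  have lim: "((\<lambda>b. (a * b) ^ k / exp (a * b)) \<longlongrightarrow> 0) at_top" for k
    using assms by (intro filterlim_compose[OF tendsto_power_div_exp_0] filterlim_tendsto_pos_mult_at_top[OF tendsto_const]) (auto intro: filterlim_ident)
  have "((\<lambda>b. (c / a) * ((a * b) ^ 1 / exp (a * b)) + (a * b) ^ 0 / exp (a * b)) \<longlongrightarrow> (c / a) * 0 + 0) at_top"
    by (intro tendsto_add tendsto_mult_left lim)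
  moreover have "(c / a) * ((a * b) ^ 1 / exp (a * b)) + (a * b) ^ 0 / exp (a * b) = (c * b + 1) * exp (- (a * b))" for b
    using assms by (simp add: exp_minus field_simps)
  ultimately show ?thesis
    by simp
qed

text \<open>Some coordinate has at least the average absolute value in the l1 bound. Norm deviations
  thereby reduce to finitely many directions.\<close>

lemma exists_signed_Basis_inner:
  fixes x :: "'v::euclidean_space"
  shows "\<exists>u \<in> Basis \<union> uminus ` Basis. norm x \<le> DIM('v) * (u \<bullet> x)"
proof (rule ccontr)
  assume *: "\<not> ?thesis"
  have "norm x \<le> (\<Sum>i\<in>Basis. \<bar>x \<bullet> i\<bar>)"
    by (rule norm_le_l1)
  also have "\<dots> < (\<Sum>i\<in>(Basis :: 'v set). norm x / DIM('v))"
  proof (intro sum_strict_mono)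
    fix i :: 'v assume i: "i \<in> Basis"
    have "DIM('v) * (u \<bullet> x) < norm x" if "u \<in> {i, - i}" for u
      using * i that by (auto simp: not_le simp del: inner_minus_left)
    from this[of i] this[of "- i"]
    have "DIM('v) * \<bar>x \<bullet> i\<bar> < norm x"
      by (cases "0 \<le> x \<bullet> i") (auto simp: inner_commute)
    then show "\<bar>x \<bullet> i\<bar> < norm x / DIM('v)"
      by (simp add: field_simps)
  qed auto
  finally show False
    by simp
qed

context iid_walk_open
begin

text \<open>
  As \<open>mgf M X \<theta> = 1\<close>, the weight \<open>exp (\<theta> \<bullet> S N)\<close> is the density of the tilted law up to time \<open>N\<close>;
  exponential Chebyshev bounds at every time replace a maximal inequality.
\<close>
lemma path_weight_ge:
  assumes \<theta>: "mgf M X \<theta> = 1" and "0 < \<eta>" "0 < c"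
  shows "\<forall>\<^sub>F b in at_top. ennreal (1 / 2) \<le>
    (\<integral>\<^sup>+\<omega>. ennreal (exp (\<theta> \<bullet> walk X (nat \<lfloor>c * b\<rfloor>) \<omega>)) *
      indicator {\<omega> \<in> space M. \<forall>k\<le>nat \<lfloor>c * b\<rfloor>. norm (walk X k \<omega> - real k *\<^sub>R grad \<theta>) \<le> \<eta> * b} \<omega> \<partial>M)"
proof -
  define g where "g = grad \<theta>"
  define U :: "'v set" where "U = Basis \<union> uminus ` Basis"
  have "finite U"
    by (simp add: U_def)
  \<comment> \<open>A deviation of norm above \<open>\<eta> * b\<close> has a component of at least
    \<open>\<eta>1 * b\<close> in a signed basis direction. The drift slack \<open>\<eta>2\<close>
    accumulates over at most \<open>c * b\<close> steps to at most half of that.\<close>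
  define \<eta>1 where "\<eta>1 = \<eta> / DIM('v)"
  define \<eta>2 where "\<eta>2 = \<eta>1 / (2 * c)"
  have pos: "0 < \<eta>1" "0 < \<eta>2"
    using assms(2,3) by (auto simp: \<eta>1_def \<eta>2_def)
  have "\<exists>t>0. mgf M X (\<theta> + t *\<^sub>R u) \<le> ennreal (exp (t * (u \<bullet> g + \<eta>2)))" for u
    using mgf_directional_decrease[of \<theta> u "u \<bullet> g + \<eta>2"] \<theta> pos by (auto simp: g_def intro: less_imp_le)
  then obtain t where t: "\<And>u. 0 < t u" "\<And>u. mgf M X (\<theta> + t u *\<^sub>R u) \<le> ennreal (exp (t u * (u \<bullet> g + \<eta>2)))"
    by metis
  have "((\<lambda>b. \<Sum>u\<in>U. (c * b + 1) * exp (- (t u * \<eta>1 / 2 * b))) \<longlongrightarrow> (\<Sum>u\<in>U. 0)) at_top"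
    using t(1) pos by (intro tendsto_sum linear_times_exp_decay) auto
  then have "\<forall>\<^sub>F b in at_top. (\<Sum>u\<in>U. (c * b + 1) * exp (- (t u * \<eta>1 / 2 * b))) < 1 / 2"
    by (intro order_tendstoD(2)) auto
  then show ?thesis
    using eventually_gt_at_top[of 0]
  proof eventually_elim
    case (elim b)
    define N where "N = nat \<lfloor>c * b\<rfloor>"
    have N: "real N \<le> c * b"
      using elim \<open>0 < c\<close> by (simp add: N_def)
    define A where "A = {\<omega> \<in> space M. \<forall>k\<le>N. norm (walk X k \<omega> - real k *\<^sub>R g) \<le> \<eta> * b}"
    have [measurable]: "A \<in> sets M"
      unfolding A_def by measurable
    \<comment> \<open>Exponential majorant of the weight on the event that the deviation at time
      \<open>k\<close> has component at least \<open>\<eta>1 * b\<close> along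
      \<open>u\<close>.\<close>
    define f where "f k u \<omega> = exp (- (t u * (k * (u \<bullet> g) + \<eta>1 * b))) *
      exp (\<theta> \<bullet> walk X N \<omega> + (t u *\<^sub>R u) \<bullet> walk X k \<omega>)" for k u \<omega>
    have [measurable]: "f k u \<in> borel_measurable M" for k u
      unfolding f_def by measurable
    have pointwise: "ennreal (exp (\<theta> \<bullet> walk X N \<omega>)) \<le>
        ennreal (exp (\<theta> \<bullet> walk X N \<omega>)) * indicator A \<omega> + (\<Sum>k\<le>N. \<Sum>u\<in>U. ennreal (f k u \<omega>))"
      if \<omega>: "\<omega> \<in> space M" for \<omega>
    proof (cases "\<omega> \<in> A")
      case False
      then obtain k where k: "k \<le> N" "\<eta> * b < norm (walk X k \<omega> - real k *\<^sub>R g)"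
        using \<omega> by (auto simp: A_def not_le)
      obtain u where u: "u \<in> U" "norm (walk X k \<omega> - real k *\<^sub>R g) \<le> DIM('v) * (u \<bullet> (walk X k \<omega> - real k *\<^sub>R g))"
        using exists_signed_Basis_inner unfolding U_def by blast
      have "\<eta>1 * b \<le> u \<bullet> (walk X k \<omega> - real k *\<^sub>R g)"
        using k(2) u(2) by (simp add: \<eta>1_def field_simps)
      then have "t u * (\<eta>1 * b) \<le> t u * (u \<bullet> (walk X k \<omega> - real k *\<^sub>R g))"
        using t(1)[of u] by (intro mult_left_mono) auto
      then have "ennreal (exp (\<theta> \<bullet> walk X N \<omega>)) \<le> ennreal (f k u \<omega>)"
        unfolding f_def by (auto simp: inner_diff_right algebra_simps intro!: ennreal_leI simp flip: exp_add)
      also have "\<dots> \<le> (\<Sum>u\<in>U. ennreal (f k u \<omega>))"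
        using u(1) \<open>finite U\<close> by (intro member_le_sum) auto
      also have "\<dots> \<le> (\<Sum>k\<le>N. \<Sum>u\<in>U. ennreal (f k u \<omega>))"
        using k(1) by (intro member_le_sum[of k "{..N}" "\<lambda>k. \<Sum>u\<in>U. ennreal (f k u \<omega>)"]) auto
      finally show ?thesis
        by (simp add: False)
    qed simp
    define I where "I = (\<integral>\<^sup>+\<omega>. ennreal (exp (\<theta> \<bullet> walk X N \<omega>)) * indicator A \<omega> \<partial>M)"
    have "1 = (\<integral>\<^sup>+\<omega>. ennreal (exp (\<theta> \<bullet> walk X N \<omega>)) \<partial>M)"
      by (simp add: mgf_walk \<theta>)
    also have "\<dots> \<le> (\<integral>\<^sup>+\<omega>. ennreal (exp (\<theta> \<bullet> walk X N \<omega>)) * indicator A \<omega> + (\<Sum>k\<le>N. \<Sum>u\<in>U. ennreal (f k u \<omega>)) \<partial>M)"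
      by (intro nn_integral_mono pointwise)
    also have "\<dots> = I + (\<Sum>k\<le>N. \<Sum>u\<in>U. \<integral>\<^sup>+\<omega>. ennreal (f k u \<omega>) \<partial>M)"
      unfolding I_def by (subst nn_integral_add) (auto simp: nn_integral_sum)
    also have "\<dots> \<le> I + (\<Sum>k\<le>N. \<Sum>u\<in>U. ennreal (exp (- (t u * \<eta>1 / 2 * b))))"
    proof (intro add_left_mono sum_mono)
      fix k u assume k: "k \<in> {..N}"
      \<comment> \<open>The steps after time \<open>k\<close> contribute powers of
        \<open>mgf M X \<theta> = 1\<close>.\<close>
      have "(\<integral>\<^sup>+\<omega>. ennreal (f k u \<omega>) \<partial>M) = ennreal (exp (- (t u * (k * (u \<bullet> g) + \<eta>1 * b)))) * mgf M X (\<theta> + t u *\<^sub>R u) ^ k"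
        unfolding f_def using k by (simp add: ennreal_mult nn_integral_cmult mgf_walk_two \<theta> del: inner_scaleR_left)
      also have "\<dots> \<le> ennreal (exp (- (t u * (k * (u \<bullet> g) + \<eta>1 * b)))) * ennreal (exp (t u * (u \<bullet> g + \<eta>2))) ^ k"
        by (intro mult_left_mono power_mono t(2)) auto
      also have "\<dots> = ennreal (exp (t u * (k * \<eta>2 - \<eta>1 * b)))"
        by (simp add: ennreal_power algebra_simps flip: ennreal_mult exp_add exp_of_nat_mult)
      also have "\<dots> \<le> ennreal (exp (- (t u * \<eta>1 / 2 * b)))"
      proof (intro ennreal_leI)
        have "real k * \<eta>2 \<le> (c * b) * \<eta>2"
          using k N pos by (intro mult_right_mono) auto
        also have "\<dots> = \<eta>1 * b / 2"
          using \<open>0 < c\<close> by (simp add: \<eta>2_def)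
        finally have "t u * (k * \<eta>2 - \<eta>1 * b) \<le> t u * (- (\<eta>1 * b / 2))"
          using t(1)[of u] by (intro mult_left_mono) auto
        then show "exp (t u * (k * \<eta>2 - \<eta>1 * b)) \<le> exp (- (t u * \<eta>1 / 2 * b))"
          by (simp add: algebra_simps)
      qed
      finally show "(\<integral>\<^sup>+\<omega>. ennreal (f k u \<omega>) \<partial>M) \<le> ennreal (exp (- (t u * \<eta>1 / 2 * b)))" .
    qed
    also have "(\<Sum>k\<le>N. \<Sum>u\<in>U. ennreal (exp (- (t u * \<eta>1 / 2 * b)))) = ennreal (\<Sum>k\<le>N. \<Sum>u\<in>U. exp (- (t u * \<eta>1 / 2 * b)))"
      by (simp only: sum_ennreal sum_nonneg exp_ge_zero)
    also have "(\<Sum>k\<le>N. \<Sum>u\<in>U. exp (- (t u * \<eta>1 / 2 * b))) = (\<Sum>u\<in>U. (real N + 1) * exp (- (t u * \<eta>1 / 2 * b)))"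
      by (simp add: sum_distrib_left add.commute)
    also have "ennreal \<dots> \<le> ennreal (\<Sum>u\<in>U. (c * b + 1) * exp (- (t u * \<eta>1 / 2 * b)))"
      using N by (intro ennreal_leI sum_mono mult_right_mono) auto
    also have "\<dots> \<le> ennreal (1 / 2)"
      using elim(1) by (intro ennreal_leI) auto
    finally have I: "1 \<le> I + ennreal (1 / 2)"
      by (simp add: add_left_mono)
    have "ennreal (1 / 2) \<le> I"
    proof (cases I)
      case (real i)
      then have "ennreal 1 \<le> ennreal (i + 1 / 2)"
        using I by (simp add: ennreal_plus)
      then have "1 \<le> i + 1 / 2"
        using real by (subst (asm) ennreal_le_iff) auto
      then show ?thesis
        unfolding \<open>I = ennreal i\<close> by (intro ennreal_leI) simp
    qed simp
    then show ?case
      by (simp add: I_def A_def N_def g_def)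
  qed
qed

text \<open>Undoes the change of measure: on the event the weight is at most \<open>E\<close>, so
  the probability is at least the weighted integral divided by \<open>E\<close>.\<close>

lemma path_probability_ge:
  assumes \<theta>: "mgf M X \<theta> = 1" and "0 < \<eta>" "0 < c" and \<epsilon>: "norm \<theta> * \<eta> < \<epsilon>"
  shows "\<forall>\<^sub>F b in at_top. ennreal (1 / 2 * exp (- (b * (\<theta> \<bullet> (c *\<^sub>R grad \<theta>) + \<epsilon>)))) \<le>
    emeasure M {\<omega> \<in> space M. \<forall>k\<le>nat \<lfloor>c * b\<rfloor>. norm (walk X k \<omega> - real k *\<^sub>R grad \<theta>) \<le> \<eta> * b}"
proof -
  define g where "g = grad \<theta>"
  \<comment> \<open>Slack in the exponent left after the endpoint deviation
    \<open>\<eta> * b\<close>; for large \<open>b\<close> it absorbs the rounding of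
    \<open>c * b\<close> to \<open>N\<close>.\<close>
  define d where "d = \<epsilon> - norm \<theta> * \<eta>"
  have d: "0 < d"
    using \<epsilon> by (simp add: d_def)
  show ?thesis
    using path_weight_ge[OF assms(1-3)] eventually_gt_at_top[of 0] eventually_ge_at_top[of "norm \<theta> * norm g / d"]
  proof eventually_elim
    case (elim b)
    define N where "N = nat \<lfloor>c * b\<rfloor>"
    define A where "A = {\<omega> \<in> space M. \<forall>k\<le>N. norm (walk X k \<omega> - real k *\<^sub>R g) \<le> \<eta> * b}"
    have [measurable]: "A \<in> sets M"
      unfolding A_def by measurable
    have N: "\<bar>real N - c * b\<bar> \<le> 1"
    proof -
      have "0 \<le> c * b"
        using elim(2) \<open>0 < c\<close> by simp
      then have "real N = of_int \<lfloor>c * b\<rfloor>"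
        by (simp add: N_def)
      then show ?thesis
        by linarith
    qed
    define E where "E = exp (b * (\<theta> \<bullet> (c *\<^sub>R g) + \<epsilon>))"
    have bound: "exp (\<theta> \<bullet> walk X N \<omega>) \<le> E" if "\<omega> \<in> A" for \<omega>
    proof -
      have "\<theta> \<bullet> (walk X N \<omega> - real N *\<^sub>R g) \<le> norm \<theta> * (\<eta> * b)"
        using that by (intro order_trans[OF norm_cauchy_schwarz] mult_left_mono) (auto simp: A_def)
      moreover have "(real N - c * b) * (\<theta> \<bullet> g) \<le> norm \<theta> * norm g"
      proof -
        have "(real N - c * b) * (\<theta> \<bullet> g) \<le> \<bar>real N - c * b\<bar> * \<bar>\<theta> \<bullet> g\<bar>"
          by (metis abs_ge_self abs_mult)
        also have "\<dots> \<le> 1 * (norm \<theta> * norm g)"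
          using N Cauchy_Schwarz_ineq2[of \<theta> g] by (intro mult_mono) auto
        finally show ?thesis by simp
      qed
      moreover have "norm \<theta> * norm g \<le> b * d"
        using elim(3) d by (simp add: pos_divide_le_eq)
      ultimately have "\<theta> \<bullet> walk X N \<omega> \<le> b * (\<theta> \<bullet> (c *\<^sub>R g) + \<epsilon>)"
        by (simp add: d_def inner_diff_right algebra_simps)
      then show ?thesis
        by (simp add: E_def)
    qed
    have "ennreal (1 / 2) \<le> (\<integral>\<^sup>+\<omega>. ennreal (exp (\<theta> \<bullet> walk X N \<omega>)) * indicator A \<omega> \<partial>M)"
      using elim(1) by (simp add: A_def N_def g_def)
    also have "\<dots> \<le> (\<integral>\<^sup>+\<omega>. ennreal E * indicator A \<omega> \<partial>M)"
      using bound by (intro nn_integral_mono) (auto simp: indicator_def intro!: ennreal_leI)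
    also have "\<dots> = ennreal E * emeasure M A"
      by (subst nn_integral_cmult_indicator) auto
    finally have "ennreal (1 / E) * ennreal (1 / 2) \<le> ennreal (1 / E) * (ennreal E * emeasure M A)"
      by (intro mult_left_mono) auto
    also have "\<dots> = emeasure M A"
      by (simp add: E_def flip: ennreal_mult mult.assoc)
    also have "ennreal (1 / E) * ennreal (1 / 2) = ennreal (1 / 2 * exp (- (b * (\<theta> \<bullet> (c *\<^sub>R g) + \<epsilon>))))"
      unfolding E_def by (subst ennreal_mult[symmetric]) (auto simp: exp_minus inverse_eq_divide)
    finally show ?case
      by (simp only: A_def N_def g_def)
  qed
qed

text \<open>Small moves from \<open>\<theta>0\<close> along all signed basis vectors stay
  admissible, and one of these vectors is well aligned with \<open>x\<close>. Where
  \<open>\<theta>0 \<bullet> x \<ge> 0\<close>, this makes the rate positive away from the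
  origin.\<close>

lemma rate_bounded_below:
  assumes "mgf M X \<theta>0 < 1"
  shows "\<exists>h>0. \<forall>x. ereal (\<theta>0 \<bullet> x + h * norm x) \<le> rate M X x"
proof -
  define U :: "'v set" where "U = Basis \<union> uminus ` Basis"
  have U: "finite U" "U \<noteq> {}"
    by (auto simp: U_def)
  obtain h where h: "\<And>u. 0 < h u" "\<And>u. mgf M X (\<theta>0 + h u *\<^sub>R u) \<le> 1"
    using mgf_le_1_nearby[OF assms] by metis
  define m where "m = Min (h ` U)"
  have m: "0 < m" "\<And>u. u \<in> U \<Longrightarrow> m \<le> h u"
    using U h(1) by (auto simp: m_def)
  have "ereal (\<theta>0 \<bullet> x + m / DIM('v) * norm x) \<le> rate M X x" for x
  proof -
    obtain u where u: "u \<in> U" "norm x \<le> DIM('v) * (u \<bullet> x)"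
      using exists_signed_Basis_inner[of x] unfolding U_def by blast
    have ux: "norm x / DIM('v) \<le> u \<bullet> x"
      using u(2) by (simp add: field_simps)
    then have "m * (norm x / DIM('v)) \<le> h u * (u \<bullet> x)"
      using m u(1) h(1)[of u] by (intro mult_mono) auto
    then have "ereal (\<theta>0 \<bullet> x + m / DIM('v) * norm x) \<le> ereal ((\<theta>0 + h u *\<^sub>R u) \<bullet> x)"
      by (simp add: inner_add_left)
    also have "\<dots> \<le> rate M X x"
      unfolding rate_def using h(2) by (intro SUP_upper) (simp add: cgf_le_0_iff)
    finally show ?thesis .
  qed
  then show ?thesis
    using m(1) by (intro exI[of _ "m / DIM('v)"]) auto
qed

end

section \<open>Geometry of paths near a segment\<close>

text \<open>Early positions lie in the scaled ball around the origin. Later ones, rescaled to the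
  end of the segment, still have an error below \<open>\<rho>\<close> and so lie in the cone over
  \<open>V\<close>.\<close>

lemma straight_path:
  fixes s :: "nat \<Rightarrow> 'v::euclidean_space"
  assumes "0 < b" "0 < c" "0 < \<delta>" and near: "\<And>k. k \<le> N \<Longrightarrow> norm (s k - real k *\<^sub>R g) \<le> \<eta> * b"
    and N: "real N \<le> c * b" "c * b \<le> real N + 1" and V: "ball (c *\<^sub>R g) \<rho> \<subseteq> V"
    and \<eta>: "2 * \<eta> < \<delta>" "2 * \<eta> * norm (c *\<^sub>R g) < \<rho> * \<delta>" "\<eta> * b + norm g < \<rho> * b"
  shows "s N \<in> (*\<^sub>R) b ` V" "\<And>k. k \<le> N \<Longrightarrow> s k \<in> (*\<^sub>R) b ` (ball 0 \<delta> \<union> pos_cone V)"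
proof -
  have img: "y \<in> (*\<^sub>R) b ` A" if "(1 / b) *\<^sub>R y \<in> A" for y and A :: "'v set"
    using that \<open>0 < b\<close> by (intro image_eqI[of _ _ "(1 / b) *\<^sub>R y"]) auto
  have "norm (s N - b *\<^sub>R (c *\<^sub>R g)) \<le> norm (s N - real N *\<^sub>R g) + norm ((real N - c * b) *\<^sub>R g)"
    by (rule order_trans[OF _ norm_triangle_ineq]) (simp add: algebra_simps)
  \<comment> \<open>\<open>N\<close> differs from \<open>c * b\<close> by at most one step, hence
    the extra \<open>norm g\<close>.\<close>
  also have "\<dots> \<le> \<eta> * b + 1 * norm g"
    using near[of N] N unfolding norm_scaleR by (intro add_mono mult_right_mono) auto
  finally have "norm (s N - b *\<^sub>R (c *\<^sub>R g)) < \<rho> * b"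
    using \<eta>(3) by simp
  moreover have "s N - b *\<^sub>R (c *\<^sub>R g) = b *\<^sub>R ((1 / b) *\<^sub>R s N - c *\<^sub>R g)"
    using \<open>0 < b\<close> by (simp add: scaleR_diff_right)
  ultimately have "norm ((1 / b) *\<^sub>R s N - c *\<^sub>R g) < \<rho>"
    using \<open>0 < b\<close> by (simp add: mult.commute)
  then show "s N \<in> (*\<^sub>R) b ` V"
    by (intro img subsetD[OF V]) (simp add: dist_norm norm_minus_commute)
  fix k assume k: "k \<le> N"
  \<comment> \<open>Elapsed fraction of time: in units of \<open>b\<close>, the ideal position at
    time \<open>k\<close> is \<open>\<tau> *\<^sub>R (c *\<^sub>R g)\<close>.\<close>
  define \<tau> where "\<tau> = real k / (c * b)"
  define y where "y = (1 / b) *\<^sub>R s k"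
  have \<tau>: "0 \<le> \<tau>"
    using \<open>0 < b\<close> \<open>0 < c\<close> by (simp add: \<tau>_def)
  have "s k - real k *\<^sub>R g = b *\<^sub>R (y - \<tau> *\<^sub>R (c *\<^sub>R g))"
    using \<open>0 < b\<close> \<open>0 < c\<close> by (simp add: y_def \<tau>_def scaleR_diff_right)
  then have "b * norm (y - \<tau> *\<^sub>R (c *\<^sub>R g)) \<le> b * \<eta>"
    using near[OF k] \<open>0 < b\<close> by (simp add: mult.commute)
  then have dev: "norm (y - \<tau> *\<^sub>R (c *\<^sub>R g)) \<le> \<eta>"
    using \<open>0 < b\<close> by simp
  have "y \<in> ball 0 \<delta> \<union> pos_cone V"
  proof (cases "\<tau> * norm (c *\<^sub>R g) + \<eta> < \<delta>")
    case True
    have "norm y \<le> norm (y - \<tau> *\<^sub>R (c *\<^sub>R g)) + norm (\<tau> *\<^sub>R (c *\<^sub>R g))"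
      by (rule order_trans[OF _ norm_triangle_ineq]) simp
    also have "\<dots> \<le> \<eta> + \<tau> * norm (c *\<^sub>R g)"
      using \<tau> unfolding norm_scaleR[of \<tau>] by (intro add_mono dev) simp
    finally have "norm y < \<delta>"
      using True by simp
    then show ?thesis
      by simp
  next
    case False
    \<comment> \<open>This bounds \<open>\<tau>\<close> from below, so that the rescaled error
      \<open>\<eta> / \<tau>\<close> is less than \<open>\<rho>\<close>.\<close>
    then have "\<delta> < 2 * (\<tau> * norm (c *\<^sub>R g))"
      using \<eta>(1) by linarith
    then have "0 < \<tau>"
      using \<tau> \<open>0 < \<delta>\<close> by (cases "\<tau> = 0") auto
    have "0 \<le> \<eta>"
      using dev norm_ge_zero order_trans by blast
    have "\<tau> * norm ((1 / \<tau>) *\<^sub>R y - c *\<^sub>R g) = norm (y - \<tau> *\<^sub>R (c *\<^sub>R g))"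
    proof -
      have "y - \<tau> *\<^sub>R (c *\<^sub>R g) = \<tau> *\<^sub>R ((1 / \<tau>) *\<^sub>R y - c *\<^sub>R g)"
        using \<open>0 < \<tau>\<close> by (simp add: scaleR_diff_right)
      then show ?thesis
        using \<open>0 < \<tau>\<close> by simp
    qed
    then have le: "\<tau> * norm ((1 / \<tau>) *\<^sub>R y - c *\<^sub>R g) \<le> \<eta>"
      using dev by simp
    have "\<delta> * \<eta> \<le> 2 * (\<tau> * norm (c *\<^sub>R g)) * \<eta>"
      using \<open>\<delta> < 2 * (\<tau> * norm (c *\<^sub>R g))\<close> \<open>0 \<le> \<eta>\<close> by (intro mult_right_mono) auto
    also have "\<dots> = \<tau> * (2 * \<eta> * norm (c *\<^sub>R g))"
      by simp
    also have "\<dots> < \<tau> * (\<rho> * \<delta>)"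
      using \<eta>(2) \<open>0 < \<tau>\<close> by (rule mult_strict_left_mono)
    also have "\<dots> = \<delta> * (\<tau> * \<rho>)"
      by simp
    finally have "\<eta> < \<tau> * \<rho>"
      using \<open>0 < \<delta>\<close> by simp
    with le have "\<tau> * norm ((1 / \<tau>) *\<^sub>R y - c *\<^sub>R g) < \<tau> * \<rho>"
      by linarith
    then have "norm ((1 / \<tau>) *\<^sub>R y - c *\<^sub>R g) < \<rho>"
      using \<open>0 < \<tau>\<close> by simp
    then have "(1 / \<tau>) *\<^sub>R y \<in> V"
      by (intro subsetD[OF V]) (simp add: dist_norm norm_minus_commute)
    moreover have "y = \<tau> *\<^sub>R ((1 / \<tau>) *\<^sub>R y)"
      using \<open>0 < \<tau>\<close> by simp
    ultimately show ?thesis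
      unfolding pos_cone_def using \<open>0 < \<tau>\<close> by blast
  qed
  then show "s k \<in> (*\<^sub>R) b ` (ball 0 \<delta> \<union> pos_cone V)"
    unfolding y_def by (rule img)
qed

section \<open>Logarithmic limits from exponential bounds\<close>

text \<open>The prefactors may depend on \<open>\<epsilon>\<close>, since their logarithms vanish
  after division by \<open>b\<close>. Half of the tolerance goes to the exponent and half to the
  prefactor; both bounds together keep \<open>p b\<close> positive and finite, where
  \<open>eln\<close> agrees with \<open>ln\<close>.\<close>

lemma eln_div_tendsto:
  fixes p :: "real \<Rightarrow> ennreal" and r :: real
  assumes upper: "\<And>\<epsilon>. 0 < \<epsilon> \<Longrightarrow> \<exists>C>0. \<forall>\<^sub>F b in at_top. p b \<le> ennreal (C * exp (- (b * (r - \<epsilon>))))"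
    and lower: "\<And>\<epsilon>. 0 < \<epsilon> \<Longrightarrow> \<exists>C>0. \<forall>\<^sub>F b in at_top. ennreal (C * exp (- (b * (r + \<epsilon>)))) \<le> p b"
  shows "((\<lambda>b. eln (p b) / ereal b) \<longlongrightarrow> - ereal r) at_top"
proof -
  have main: "\<forall>\<^sub>F b in at_top. eln (p b) / ereal b = ereal (ln (enn2real (p b)) / b) \<and> dist (ln (enn2real (p b)) / b) (- r) < \<epsilon>"
    if "0 < \<epsilon>" for \<epsilon>
  proof -
    have e2: "0 < \<epsilon> / 2"
      using that by simp
    obtain C where C: "0 < C" "\<forall>\<^sub>F b in at_top. p b \<le> ennreal (C * exp (- (b * (r - \<epsilon> / 2))))"
      using upper[OF e2] by blast
    obtain D where D: "0 < D" "\<forall>\<^sub>F b in at_top. ennreal (D * exp (- (b * (r + \<epsilon> / 2)))) \<le> p b"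
      using lower[OF e2] by blast
    show ?thesis
      using C(2) D(2) eventually_gt_at_top[of 0] eventually_gt_at_top[of "ln C / (\<epsilon> / 2)"] eventually_gt_at_top[of "- ln D / (\<epsilon> / 2)"]
    proof eventually_elim
      case (elim b)
      then obtain q where q: "0 \<le> q" "p b = ennreal q"
        by (cases "p b") (auto simp: top_unique)
      have le: "q \<le> C * exp (- (b * (r - \<epsilon> / 2)))"
        using elim(1) C(1) by (simp add: q ennreal_le_iff)
      have ge: "D * exp (- (b * (r + \<epsilon> / 2))) \<le> q"
        using elim(2) q(1) by (simp add: q(2) ennreal_le_iff)
      have "0 < q"
        by (rule less_le_trans[OF mult_pos_pos[OF D(1) exp_gt_zero] ge])
      then have "ln q \<le> ln (C * exp (- (b * (r - \<epsilon> / 2))))" "ln (D * exp (- (b * (r + \<epsilon> / 2)))) \<le> ln q"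
        using le ge C(1) D(1) by (intro ln_mono; simp)+
      then have "ln q \<le> ln C - b * (r - \<epsilon> / 2)" "ln D - b * (r + \<epsilon> / 2) \<le> ln q"
        using C(1) D(1) by (simp_all add: ln_mult)
      moreover have "ln C < b * (\<epsilon> / 2)" "- ln D < b * (\<epsilon> / 2)"
        using elim(4,5) e2 by (simp_all only: pos_divide_less_eq)
      ultimately have "ln q + b * r < b * \<epsilon>" "- (b * \<epsilon>) < ln q + b * r"
        by (auto simp: algebra_simps)
      then have "\<bar>ln q + b * r\<bar> < b * \<epsilon>"
        by linarith
      moreover have "ln q / b + r = (ln q + b * r) / b"
        using elim(3) by (simp add: field_simps)
      ultimately have "dist (ln q / b) (- r) < \<epsilon>"
        using elim(3) by (simp add: dist_real_def abs_divide pos_divide_less_eq mult.commute)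
      then show ?case
        using q \<open>0 < q\<close> elim(3) by (simp add: eln_def)
    qed
  qed
  have "((\<lambda>b. ln (enn2real (p b)) / b) \<longlongrightarrow> - r) at_top"
  proof (rule tendstoI)
    fix \<epsilon> :: real assume "0 < \<epsilon>"
    from main[OF this] show "\<forall>\<^sub>F b in at_top. dist (ln (enn2real (p b)) / b) (- r) < \<epsilon>"
      by (rule eventually_mono) (erule conjunct2)
  qed
  then have "((\<lambda>b. ereal (ln (enn2real (p b)) / b)) \<longlongrightarrow> ereal (- r)) at_top"
    by (rule tendsto_ereal)
  moreover have "\<forall>\<^sub>F b in at_top. eln (p b) / ereal b = ereal (ln (enn2real (p b)) / b)"
    using main[OF zero_less_one] by (rule eventually_mono) (erule conjunct1)
  ultimately show ?thesis
    by (subst tendsto_cong) auto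
qed

section \<open>Hitting times and measurability\<close>

text \<open>A nonempty set in \<open>enat\<close> attains its infimum, so a finite hitting time is
  an actual visit.\<close>

lemma hit_le_iff: "hit X A b \<omega> \<le> enat n \<longleftrightarrow> (\<exists>m\<le>n. walk X m \<omega> \<in> (*\<^sub>R) b ` A)"
proof
  assume le: "hit X A b \<omega> \<le> enat n"
  let ?S = "{enat n | n. walk X n \<omega> \<in> (*\<^sub>R) b ` A}"
  have "?S \<noteq> {}"
  proof
    assume "?S = {}"
    then have "hit X A b \<omega> = \<infinity>"
      unfolding hit_def by (simp add: top_enat_def)
    then show False
      using le by simp
  qed
  then obtain e where "e \<in> ?S"
    by blast
  then have "(LEAST e. e \<in> ?S) \<in> ?S"
    by (rule LeastI)
  then have "Inf ?S \<in> ?S"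
    using \<open>?S \<noteq> {}\<close> by (simp only: Inf_enat_def if_False)
  then show "\<exists>m\<le>n. walk X m \<omega> \<in> (*\<^sub>R) b ` A"
    using le unfolding hit_def by auto
next
  assume "\<exists>m\<le>n. walk X m \<omega> \<in> (*\<^sub>R) b ` A"
  then obtain m where "m \<le> n" "walk X m \<omega> \<in> (*\<^sub>R) b ` A"
    by blast
  then show "hit X A b \<omega> \<le> enat n"
    unfolding hit_def by (intro Inf_lower2[of "enat m"]) auto
qed

text \<open>Quantifiers over \<open>nat\<close> replace the infima, which serves both measurability
  and inclusions between path events.\<close>

lemma hit_less_iff:
  "hit X A b \<omega> < hit X B b \<omega> \<longleftrightarrow>
    (\<exists>n. walk X n \<omega> \<in> (*\<^sub>R) b ` A \<and> (\<forall>k\<le>n. walk X k \<omega> \<notin> (*\<^sub>R) b ` B))"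
proof
  assume less: "hit X A b \<omega> < hit X B b \<omega>"
  then obtain n where n: "hit X A b \<omega> = enat n"
    by (cases "hit X A b \<omega>") auto
  then obtain m where m: "m \<le> n" "walk X m \<omega> \<in> (*\<^sub>R) b ` A"
    using hit_le_iff[of X A b \<omega> n] by auto
  moreover have "\<not> hit X B b \<omega> \<le> enat m"
    using less n m(1) by (metis enat_ord_simps(1) leD order_trans)
  ultimately show "\<exists>n. walk X n \<omega> \<in> (*\<^sub>R) b ` A \<and> (\<forall>k\<le>n. walk X k \<omega> \<notin> (*\<^sub>R) b ` B)"
    unfolding hit_le_iff by blast
next
  assume "\<exists>n. walk X n \<omega> \<in> (*\<^sub>R) b ` A \<and> (\<forall>k\<le>n. walk X k \<omega> \<notin> (*\<^sub>R) b ` B)"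
  then obtain n where "hit X A b \<omega> \<le> enat n" "\<not> hit X B b \<omega> \<le> enat n"
    unfolding hit_le_iff by blast
  then show "hit X A b \<omega> < hit X B b \<omega>"
    by simp
qed

lemma first_hit_less_iff:
  assumes "1 \<le> J"
  shows "first_hit X W J b \<omega> < h \<longleftrightarrow> (\<exists>j\<in>{1..J}. hit X (W j) b \<omega> < h)"
  using assms unfolding first_hit_def by (subst Min_less_iff) auto

text \<open>Negated strict comparisons let the measurability of
  \<open>hit X A b \<omega> < hit X B b \<omega>\<close> carry over to equality.\<close>

lemma first_hit_eq_iff:
  assumes "j \<in> {1..J}"
  shows "first_hit X W J b \<omega> = hit X (W j) b \<omega> \<longleftrightarrow> (\<forall>i\<in>{1..J}. \<not> hit X (W i) b \<omega> < hit X (W j) b \<omega>)"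
  using assms unfolding first_hit_def by (subst Min_eq_iff) (auto simp: not_less)

lemma (in iid_walk) hit_less_sets [measurable]:
  assumes "0 < b" "open A" "open B"
  shows "Measurable.pred M (\<lambda>\<omega>. hit X A b \<omega> < hit X B b \<omega>)"
proof -
  have [measurable]: "(*\<^sub>R) b ` A \<in> sets borel" "(*\<^sub>R) b ` B \<in> sets borel"
    using assms by (intro borel_open open_scaling; simp)+
  show ?thesis
    unfolding hit_less_iff by measurable
qed


text \<open>Monotonicity of \<open>emeasure\<close> asks for a measurable larger set; the lower
  bounds apply it to these events.\<close>

lemma (in iid_walk) first_hit_sets:
  assumes "0 < b" "1 \<le> J" and op: "\<And>i. i \<le> J \<Longrightarrow> open (W i)" and "j \<in> {1..J}"
  shows "{\<omega> \<in> space M. first_hit X W J b \<omega> < hit X (W 0) b \<omega>} \<in> sets M"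
    and "{\<omega> \<in> space M. first_hit X W J b \<omega> < hit X (W 0) b \<omega> \<and> first_hit X W J b \<omega> = hit X (W j) b \<omega>} \<in> sets M"
proof -
  have [measurable]: "Measurable.pred M (\<lambda>\<omega>. hit X (W i) b \<omega> < hit X (W k) b \<omega>)" if "i \<le> J" "k \<le> J" for i k
    using assms that by (intro hit_less_sets) auto
  have [measurable]: "Measurable.pred M (\<lambda>\<omega>. \<exists>i\<in>{1..J}. hit X (W i) b \<omega> < hit X (W 0) b \<omega>)"
    by (intro pred_intros_finite) auto
  have [measurable]: "Measurable.pred M (\<lambda>\<omega>. \<forall>i\<in>{1..J}. \<not> hit X (W i) b \<omega> < hit X (W j) b \<omega>)"
    using \<open>j \<in> {1..J}\<close> by (intro pred_intros_finite pred_intros_logic) auto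
  show "{\<omega> \<in> space M. first_hit X W J b \<omega> < hit X (W 0) b \<omega>} \<in> sets M"
    unfolding first_hit_less_iff[OF \<open>1 \<le> J\<close>] by measurable
  show "{\<omega> \<in> space M. first_hit X W J b \<omega> < hit X (W 0) b \<omega> \<and> first_hit X W J b \<omega> = hit X (W j) b \<omega>} \<in> sets M"
    unfolding first_hit_less_iff[OF \<open>1 \<le> J\<close>] first_hit_eq_iff[OF \<open>j \<in> {1..J}\<close>] by measurable
qed

section \<open>Interior points of nearly minimal rate\<close>

context iid_walk
begin

text \<open>For admissible \<open>\<theta>\<close> the term \<open>cgf M X \<theta>\<close> is
  nonpositive, so \<open>\<theta> \<bullet> y\<close> is at most the conjugate at \<open>y\<close>;
  scaling extends this to the cone. The interior point in \<open>C2\<close> thus lies in the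
  interior of \<open>ratedom\<close>.\<close>

lemma cgf_conj_dom_subset: "pos_cone (eff_dom (cgf_conj M X)) \<subseteq> ratedom"
proof
  fix x assume "x \<in> pos_cone (eff_dom (cgf_conj M X))"
  then obtain a y where y: "x = a *\<^sub>R y" "0 < a" "cgf_conj M X y < \<infinity>"
    unfolding pos_cone_def eff_dom_def by auto
  then obtain t where t: "cgf_conj M X y \<le> ereal t"
    by (cases "cgf_conj M X y") (auto intro: that)
  have "\<theta> \<bullet> x \<le> a * t" if "mgf M X \<theta> \<le> 1" for \<theta>
  proof -
    have "ereal (\<theta> \<bullet> y) - 0 \<le> ereal (\<theta> \<bullet> y) - cgf M X \<theta>"
      using that by (intro ereal_minus_mono) (auto simp: cgf_le_0_iff)
    also have "\<dots> \<le> cgf_conj M X y"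
      unfolding cgf_conj_def by (intro SUP_upper) auto
    also note t
    finally have "\<theta> \<bullet> y \<le> t"
      by simp
    then show ?thesis
      using y by simp
  qed
  then show "x \<in> ratedom"
    unfolding ratedom_def rate_le_iff by blast
qed

lemma rate_convex:
  assumes "rate M X x \<le> ereal s" "rate M X y \<le> ereal t" "0 \<le> u" "0 \<le> v"
  shows "rate M X (u *\<^sub>R x + v *\<^sub>R y) \<le> ereal (u * s + v * t)"
  using assms unfolding rate_le_iff
  by (auto simp: inner_add_right intro!: add_mono mult_left_mono)

lemma convex_ratedom: "convex ratedom"
  unfolding ratedom_def by (intro convexI) (use rate_convex in blast)

text \<open>A near minimiser may lie on the boundary of \<open>ratedom\<close>. A small move towards
  \<open>x0\<close> makes it interior and, by convexity of the rate, costs little.\<close>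

lemma near_minimizer:
  assumes W: "convex W" and x0: "x0 \<in> W" "x0 \<in> interior ratedom"
    and r: "min_rate M X W = ereal r" and "0 < \<epsilon>"
  shows "\<exists>x\<in>W \<inter> interior ratedom. rate M X x \<le> ereal (r + \<epsilon>)"
proof -
  have "min_rate M X W < ereal (r + \<epsilon> / 2)"
    using \<open>0 < \<epsilon>\<close> by (simp add: r)
  then obtain x1 where x1: "x1 \<in> W" "rate M X x1 \<le> ereal (r + \<epsilon> / 2)"
    unfolding min_rate_def INF_less_iff by (auto intro: less_imp_le)
  obtain t where t: "rate M X x0 \<le> ereal t"
    using x0(2) interior_subset by (auto simp: ratedom_def)
  define d where "d = \<bar>t - (r + \<epsilon> / 2)\<bar>"
  \<comment> \<open>The move raises the bound on the rate by at most
    \<open>s * d \<le> \<epsilon> / 2\<close>; the \<open>+ 1\<close> avoids division by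
    zero.\<close>
  define s where "s = min 1 (\<epsilon> / 2 / (d + 1))"
  have d: "0 \<le> d"
    by (simp add: d_def)
  then have s: "0 < s" "s \<le> 1"
    using \<open>0 < \<epsilon>\<close> by (auto simp: s_def)
  have "s \<le> \<epsilon> / 2 / (d + 1)" "0 < d + 1"
    using d by (auto simp: s_def)
  then have sd: "s * (d + 1) \<le> \<epsilon> / 2"
    by (simp only: pos_le_divide_eq)
  have "s * (t - (r + \<epsilon> / 2)) \<le> s * (d + 1)"
    using s by (intro mult_left_mono) (auto simp: d_def)
  moreover have "(1 - s) * (r + \<epsilon> / 2) + s * t = r + \<epsilon> / 2 + s * (t - (r + \<epsilon> / 2))"
    by (simp add: field_simps)
  ultimately have "(1 - s) * (r + \<epsilon> / 2) + s * t \<le> r + \<epsilon>"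
    using sd by linarith
  moreover have "rate M X ((1 - s) *\<^sub>R x1 + s *\<^sub>R x0) \<le> ereal ((1 - s) * (r + \<epsilon> / 2) + s * t)"
    using s by (intro rate_convex x1 t) auto
  ultimately have "rate M X ((1 - s) *\<^sub>R x1 + s *\<^sub>R x0) \<le> ereal (r + \<epsilon>)"
    by (meson ereal_less_eq(3) order_trans)
  moreover have "(1 - s) *\<^sub>R x1 + s *\<^sub>R x0 \<in> W"
    using W x0(1) x1(1) s by (intro convexD) auto
  moreover have "x1 - s *\<^sub>R (x1 - x0) \<in> interior ratedom"
    using x1(2) s by (intro mem_interior_convex_shrink convex_ratedom x0) (auto simp: ratedom_def)
  then have "(1 - s) *\<^sub>R x1 + s *\<^sub>R x0 \<in> interior ratedom"
    by (simp add: algebra_simps)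
  ultimately show ?thesis
    by blast
qed

end

section \<open>Probability of reaching a given target first\<close>

context iid_walk_open
begin

text \<open>Writing \<open>x\<close> as \<open>c *\<^sub>R grad \<theta>\<close> makes it the
  endpoint of the tilted drift. Paths near that segment stay in the scaled ball around the origin or
  in the cone over \<open>W j\<close>, both of which \<open>C3\<close> keeps clear of the other
  targets.\<close>

lemma hitting_probability_ge:
  assumes "1 \<le> J" and op: "\<And>i. i \<le> J \<Longrightarrow> open (W i)" and "C3 W J" and j: "j \<in> {1..J}"
    and x: "x \<in> W j" "x \<in> interior ratedom" "rate M X x \<le> ereal \<rho>"
    and \<theta>0: "mgf M X \<theta>0 < 1" and "0 < \<epsilon>"
  shows "\<forall>\<^sub>F b in at_top. ennreal (1 / 2 * exp (- (b * (\<rho> + \<epsilon>)))) \<le>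
    emeasure M {\<omega> \<in> space M. first_hit X W J b \<omega> < hit X (W 0) b \<omega> \<and> first_hit X W J b \<omega> = hit X (W j) b \<omega>}"
proof -
  obtain \<delta> where \<delta>: "0 < \<delta>" "\<And>i. i \<le> J \<Longrightarrow> ball 0 \<delta> \<inter> W i = {}"
    using \<open>C3 W J\<close> unfolding C3_def by auto
  have cones: "pos_cone (W j) \<inter> W i = {}" if "i \<le> J" "i \<noteq> j" for i
  proof -
    have "W i \<subseteq> pos_cone (W i)"
      unfolding pos_cone_def by (force intro: exI[of _ 1])
    moreover have "pos_cone (W j) \<inter> pos_cone (W i) = {}"
      using \<open>C3 W J\<close> j that unfolding C3_def by auto
    ultimately show ?thesis
      by blast
  qed
  have "x \<noteq> 0"
    using \<delta>(1) \<delta>(2)[of j] x(1) j by force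
  then obtain \<theta> c where \<theta>: "0 < c" "mgf M X \<theta> = 1" "x = c *\<^sub>R grad \<theta>" "rate M X x = ereal (\<theta> \<bullet> x)"
    using rate_attained_grad x(2) \<theta>0 by blast
  obtain \<rho>0 where \<rho>0: "0 < \<rho>0" "ball x \<rho>0 \<subseteq> W j"
    using op[of j] j x(1) by (auto simp: open_contains_ball)
  have small: "\<forall>\<^sub>F \<eta> in at_right 0. a * \<eta> < \<beta>" if "0 < \<beta>" for a \<beta> :: real
  proof (rule order_tendstoD(2)[OF _ that])
    show "((\<lambda>\<eta>. a * \<eta>) \<longlongrightarrow> 0) (at_right 0)"
      by (auto intro!: tendsto_eq_intros)
  qed
  \<comment> \<open>The bounds with \<open>\<delta>\<close> keep the path in the ball or the cone,
    \<open>\<eta> < \<rho>0\<close> places its endpoint in the target for large \<open>b\<close>,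
    and the last one limits the loss in the exponent.\<close>
  have "\<forall>\<^sub>F \<eta> in at_right 0. 0 < \<eta> \<and> 2 * \<eta> < \<delta> \<and> (2 * norm x) * \<eta> < \<rho>0 * \<delta> \<and> 1 * \<eta> < \<rho>0 \<and> norm \<theta> * \<eta> < \<epsilon>"
    using \<delta>(1) \<rho>0(1) \<open>0 < \<epsilon>\<close> by (intro eventually_conj small eventually_at_right_less) auto
  from eventually_happens'[OF trivial_limit_at_right_real this]
  obtain \<eta> where \<eta>: "0 < \<eta>" "2 * \<eta> < \<delta>" "(2 * norm x) * \<eta> < \<rho>0 * \<delta>" "\<eta> < \<rho>0" "norm \<theta> * \<eta> < \<epsilon>"
    unfolding mult_1 by blast
  show ?thesis
    using path_probability_ge[OF \<theta>(2) \<eta>(1) \<theta>(1) \<eta>(5)] eventually_gt_at_top[of 0]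
      eventually_gt_at_top[of "norm (grad \<theta>) / (\<rho>0 - \<eta>)"]
  proof eventually_elim
    case (elim b)
    define N where "N = nat \<lfloor>c * b\<rfloor>"
    have "0 \<le> c * b"
      using elim(2) \<theta>(1) by simp
    then have "real N = of_int \<lfloor>c * b\<rfloor>"
      by (simp add: N_def)
    then have N: "real N \<le> c * b" "c * b \<le> real N + 1"
      by linarith+
    have far: "\<eta> * b + norm (grad \<theta>) < \<rho>0 * b"
      using elim(3) \<eta>(4) by (simp add: pos_divide_less_eq algebra_simps)
    have hits: "hit X (W j) b \<omega> < hit X (W i) b \<omega>"
      if near: "\<forall>k\<le>N. norm (walk X k \<omega> - real k *\<^sub>R grad \<theta>) \<le> \<eta> * b" and i: "i \<le> J" "i \<noteq> j" for \<omega> i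
    proof -
      have V: "ball (c *\<^sub>R grad \<theta>) \<rho>0 \<subseteq> W j"
        using \<rho>0(2) \<theta>(3) by simp
      have cone: "2 * \<eta> * norm (c *\<^sub>R grad \<theta>) < \<rho>0 * \<delta>"
        using \<eta>(3) by (simp add: \<theta>(3)[symmetric] mult_ac)
      have near': "norm (walk X k \<omega> - real k *\<^sub>R grad \<theta>) \<le> \<eta> * b" if "k \<le> N" for k
        using near that by blast
      note path = straight_path[of b c \<delta> N "\<lambda>k. walk X k \<omega>", OF elim(2) \<theta>(1) \<delta>(1) near' N V \<eta>(2) cone far]
      have "walk X N \<omega> \<in> (*\<^sub>R) b ` W j"
        by (rule path(1))
      moreover have "walk X k \<omega> \<notin> (*\<^sub>R) b ` W i" if "k \<le> N" for k
      proof
        assume "walk X k \<omega> \<in> (*\<^sub>R) b ` W i"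
        then obtain y where y: "y \<in> W i" "walk X k \<omega> = b *\<^sub>R y"
          by blast
        have "walk X k \<omega> \<in> (*\<^sub>R) b ` (ball 0 \<delta> \<union> pos_cone (W j))"
          by (rule path(2)) (use that in auto)
        then obtain z where z: "z \<in> ball 0 \<delta> \<union> pos_cone (W j)" "walk X k \<omega> = b *\<^sub>R z"
          by blast
        have "y = z"
          using y(2) z(2) elim(2) by simp
        then show False
          using y(1) z(1) cones[OF i] \<delta>(2)[OF i(1)] by blast
      qed
      ultimately show ?thesis
        unfolding hit_less_iff by blast
    qed
    have sub: "{\<omega> \<in> space M. \<forall>k\<le>N. norm (walk X k \<omega> - real k *\<^sub>R grad \<theta>) \<le> \<eta> * b} \<subseteq>
      {\<omega> \<in> space M. first_hit X W J b \<omega> < hit X (W 0) b \<omega> \<and> first_hit X W J b \<omega> = hit X (W j) b \<omega>}"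
    proof safe
      fix \<omega> assume near: "\<forall>k\<le>N. norm (walk X k \<omega> - real k *\<^sub>R grad \<theta>) \<le> \<eta> * b"
      show "first_hit X W J b \<omega> < hit X (W 0) b \<omega>"
        unfolding first_hit_less_iff[OF \<open>1 \<le> J\<close>] using hits[OF near, of 0] j by auto
      show "first_hit X W J b \<omega> = hit X (W j) b \<omega>"
        unfolding first_hit_eq_iff[OF j] using hits[OF near] by (metis atLeastAtMost_iff less_asym)
    qed
    have "\<theta> \<bullet> x \<le> \<rho>"
      using x(3) \<theta>(4) by simp
    then have "ennreal (1 / 2 * exp (- (b * (\<rho> + \<epsilon>)))) \<le> ennreal (1 / 2 * exp (- (b * (\<theta> \<bullet> x + \<epsilon>))))"
      using elim(2) by (intro ennreal_leI) simp
    also have "\<dots> \<le> emeasure M {\<omega> \<in> space M. \<forall>k\<le>N. norm (walk X k \<omega> - real k *\<^sub>R grad \<theta>) \<le> \<eta> * b}"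
      using elim(1) unfolding N_def \<theta>(3)[symmetric] .
    also have "\<dots> \<le> emeasure M {\<omega> \<in> space M. first_hit X W J b \<omega> < hit X (W 0) b \<omega> \<and> first_hit X W J b \<omega> = hit X (W j) b \<omega>}"
      by (intro emeasure_mono sub first_hit_sets(2)) (use elim(2) assms in auto)
    finally show ?case .
  qed
qed

end

section \<open>Assembly of the upper and lower bounds into limits\<close>

theorem theorem3p1:
  fixes M :: "'w measure"
    and X :: "nat \<Rightarrow> 'w \<Rightarrow> real ^ 'd"
    and W :: "nat \<Rightarrow> (real ^ 'd) set"
    and J :: nat
  assumes "prob_space M"
    and "iid_seq M X"
    and "1 \<le> J"
    and "open (W 0)"
    and "\<And>j. j \<in> {1..J} \<Longrightarrow> open (W j) \<and> convex (W j)"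
    and "C1 M X W J"
    and "C2 M X W J"
    and "C3 W J"
  shows "(\<forall>j\<in>{1..J}.
            ((\<lambda>b. eln (emeasure M {\<omega> \<in> space M. first_hit X W J b \<omega> < hit X (W 0) b \<omega> \<and>
                                    first_hit X W J b \<omega> = hit X (W j) b \<omega>}) / ereal b)
              \<longlongrightarrow> - min_rate M X (W j)) at_top) \<and>
         ((\<lambda>b. eln (emeasure M {\<omega> \<in> space M. first_hit X W J b \<omega> < hit X (W 0) b \<omega>}) / ereal b)
              \<longlongrightarrow> - Min ((\<lambda>j. min_rate M X (W j)) ` {1..J})) at_top \<and>
         (\<forall>j\<in>{1..J}. 0 < min_rate M X (W j) \<and> min_rate M X (W j) < \<infinity>)"
proof -
  interpret prob_space M by fact
  interpret iid_walk_open M X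
    using assms(2,7) by unfold_locales (auto simp: C2_def eff_dom_cgf)
  have op: "open (W i)" if "i \<le> J" for i
    using assms(4,5) that by (cases "i = 0") auto
  define ev where "ev j b = {\<omega> \<in> space M. first_hit X W J b \<omega> < hit X (W 0) b \<omega> \<and> first_hit X W J b \<omega> = hit X (W j) b \<omega>}" for j b
  define ev' where "ev' b = {\<omega> \<in> space M. first_hit X W J b \<omega> < hit X (W 0) b \<omega>}" for b
  define hits where "hits j b = {\<omega> \<in> space M. \<exists>n. walk X n \<omega> \<in> (*\<^sub>R) b ` W j}" for j b
  obtain \<delta>1 where \<delta>1: "0 < \<delta>1" "\<And>j. j \<in> {1..J} \<Longrightarrow> pos_cone (ball (\<integral>\<omega>. X 1 \<omega> \<partial>M) \<delta>1) \<inter> W j = {}"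
    using assms(6) unfolding C1_def by blast
  obtain \<delta> where \<delta>: "0 < \<delta>" "\<And>j. j \<in> {1..J} \<Longrightarrow> ball 0 \<delta> \<inter> W j = {}"
    using assms(8) unfolding C3_def by fastforce
  have "\<exists>x. x \<in> W j \<and> x \<in> interior ratedom" if "j \<in> {1..J}" for j
    using assms(7) that interior_mono[OF cgf_conj_dom_subset] unfolding C2_def by blast
  then obtain x0 where x0: "\<And>j. j \<in> {1..J} \<Longrightarrow> x0 j \<in> W j" "\<And>j. j \<in> {1..J} \<Longrightarrow> x0 j \<in> interior ratedom"
    by metis
  have "\<exists>\<theta>. mgf M X \<theta> < 1 \<and> (\<forall>x\<in>W j. 0 \<le> \<theta> \<bullet> x)" if j: "j \<in> {1..J}" for j
    using assms(5)[OF j] x0(1)[OF j] \<delta>1(1) \<delta>1(2)[OF j] by (intro exists_mgf_less_1) auto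
  then obtain \<theta>0 where \<theta>0: "\<And>j. j \<in> {1..J} \<Longrightarrow> mgf M X (\<theta>0 j) < 1"
      "\<And>j x. j \<in> {1..J} \<Longrightarrow> x \<in> W j \<Longrightarrow> 0 \<le> \<theta>0 j \<bullet> x"
    by metis
  \<comment> \<open>Positivity: the rate grows linearly in the norm and \<open>W j\<close> stays at
    distance \<open>\<delta>\<close> from the origin. Finiteness: the rate is finite at
    \<open>x0 j\<close>.\<close>
  have finite_rate: "0 < min_rate M X (W j) \<and> min_rate M X (W j) < \<infinity>" if j: "j \<in> {1..J}" for j
  proof
    obtain h where h: "0 < h" "\<And>x. ereal (\<theta>0 j \<bullet> x + h * norm x) \<le> rate M X x"
      using rate_bounded_below[OF \<theta>0(1)[OF j]] by blast
    have "ereal (h * \<delta>) \<le> rate M X x" if "x \<in> W j" for x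
    proof -
      have "\<delta> \<le> norm x"
        using \<delta>(2)[OF j] that by (metis disjoint_iff mem_ball_0 not_le)
      then have "h * \<delta> \<le> \<theta>0 j \<bullet> x + h * norm x"
        using h(1) \<theta>0(2)[OF j that] by (simp add: add_increasing)
      then show ?thesis
        using h(2)[of x] by (meson ereal_less_eq(3) order_trans)
    qed
    then have "ereal (h * \<delta>) \<le> min_rate M X (W j)"
      unfolding min_rate_def by (intro INF_greatest)
    moreover have "0 < ereal (h * \<delta>)"
      using h(1) \<delta>(1) by simp
    ultimately show "0 < min_rate M X (W j)"
      by (rule less_le_trans[rotated])
    obtain t where "rate M X (x0 j) \<le> ereal t"
      using x0(2)[OF j] interior_subset by (auto simp: ratedom_def)
    then show "min_rate M X (W j) < \<infinity>"
      unfolding min_rate_def by (intro le_less_trans[OF INF_lower[OF x0(1)[OF j]]]) (auto intro: le_less_trans)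
  qed
  define r where "r j = real_of_ereal (min_rate M X (W j))" for j
  have r: "min_rate M X (W j) = ereal (r j)" "0 < r j" if "j \<in> {1..J}" for j
    using finite_rate[OF that] by (cases "min_rate M X (W j)"; simp add: r_def)+
  have upper: "\<exists>C>0. \<forall>b>0. emeasure M (hits j b) \<le> ennreal (C * exp (- (b * (r j - \<epsilon>))))"
    if j: "j \<in> {1..J}" and "0 < \<epsilon>" for j \<epsilon>
  proof -
    have "ereal (r j) \<le> rate M X x" if "x \<in> W j" for x
      unfolding r(1)[OF j, symmetric] min_rate_def using that by (rule INF_lower)
    then obtain \<theta> where \<theta>: "mgf M X \<theta> \<le> 1" "\<And>x. x \<in> W j \<Longrightarrow> r j \<le> \<theta> \<bullet> x"
      using exists_exponent[of "W j" "x0 j" "r j"] assms(5)[OF j] x0[OF j] by blast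
    show ?thesis
      unfolding hits_def
      using emeasure_walk_hits_le[OF _ \<theta> \<theta>0(1)[OF j] \<theta>0(2)[OF j] r(2)[OF j] \<open>0 < \<epsilon>\<close>] assms(5)[OF j] by blast
  qed
  have lower: "\<forall>\<^sub>F b in at_top. ennreal (1 / 2 * exp (- (b * (r j + \<epsilon>)))) \<le> emeasure M (ev j b)"
    if j: "j \<in> {1..J}" and "0 < \<epsilon>" for j \<epsilon>
  proof -
    \<comment> \<open>One half of \<open>\<epsilon>\<close> pays for the near minimiser, the other
      for following the path.\<close>
    have e2: "0 < \<epsilon> / 2"
      using \<open>0 < \<epsilon>\<close> by simp
    obtain x where x: "x \<in> W j" "x \<in> interior ratedom" "rate M X x \<le> ereal (r j + \<epsilon> / 2)"
      using near_minimizer[OF _ x0(1)[OF j] x0(2)[OF j] r(1)[OF j] e2] assms(5)[OF j] by blast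
    have half: "r j + \<epsilon> / 2 + \<epsilon> / 2 = r j + \<epsilon>"
      by simp
    show ?thesis
      using hitting_probability_ge[OF assms(3) op assms(8) j x \<theta>0(1)[OF j] e2] unfolding ev_def half .
  qed
  have hits_sets: "hits j b \<in> sets M" if "j \<in> {1..J}" "0 < b" for j b
  proof -
    have [measurable]: "(*\<^sub>R) b ` W j \<in> sets borel"
      using that assms(5) by (intro borel_open open_scaling) auto
    show ?thesis
      unfolding hits_def by measurable
  qed
  have hit_mem: "\<omega> \<in> hits j b" if \<omega>: "\<omega> \<in> space M" "hit X (W j) b \<omega> < h" for \<omega> j b h
  proof -
    obtain n where "hit X (W j) b \<omega> \<le> enat n"
      using \<omega>(2) by (cases "hit X (W j) b \<omega>") auto
    then show ?thesis
      unfolding hits_def hit_le_iff using \<omega>(1) by blast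
  qed
  have lim: "((\<lambda>b. eln (emeasure M (ev j b)) / ereal b) \<longlongrightarrow> - min_rate M X (W j)) at_top" if j: "j \<in> {1..J}" for j
    unfolding r(1)[OF j]
  proof (rule eln_div_tendsto)
    fix \<epsilon> :: real assume "0 < \<epsilon>"
    obtain C where C: "0 < C" "\<And>b. 0 < b \<Longrightarrow> emeasure M (hits j b) \<le> ennreal (C * exp (- (b * (r j - \<epsilon>))))"
      using upper[OF j \<open>0 < \<epsilon>\<close>] by blast
    have "emeasure M (ev j b) \<le> ennreal (C * exp (- (b * (r j - \<epsilon>))))" if "0 < b" for b
    proof -
      \<comment> \<open>The upper bound ignores the order of visits and counts every visit to the
        target.\<close>
      have "ev j b \<subseteq> hits j b"
        using hit_mem unfolding ev_def by auto
      then have "emeasure M (ev j b) \<le> emeasure M (hits j b)"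
        using hits_sets j that by (intro emeasure_mono)
      then show ?thesis
        using C(2)[OF that] by (rule order_trans)
    qed
    then show "\<exists>C>0. \<forall>\<^sub>F b in at_top. emeasure M (ev j b) \<le> ennreal (C * exp (- (b * (r j - \<epsilon>))))"
      using C(1) by (intro exI[of _ C]) (auto intro: eventually_mono[OF eventually_gt_at_top[of 0]])
    show "\<exists>C>0. \<forall>\<^sub>F b in at_top. ennreal (C * exp (- (b * (r j + \<epsilon>)))) \<le> emeasure M (ev j b)"
      using lower[OF j \<open>0 < \<epsilon>\<close>] by (intro exI[of _ "1 / 2"]) simp
  qed
  have "Min ((\<lambda>j. min_rate M X (W j)) ` {1..J}) \<in> (\<lambda>j. min_rate M X (W j)) ` {1..J}"
    using assms(3) by (intro Min_in) auto
  then obtain i where i: "i \<in> {1..J}" "Min ((\<lambda>j. min_rate M X (W j)) ` {1..J}) = min_rate M X (W i)"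
    by blast
  have i_le: "r i \<le> r j" if "j \<in> {1..J}" for j
  proof -
    have "min_rate M X (W i) \<le> min_rate M X (W j)"
      unfolding i(2)[symmetric] using that by (intro Min_le) auto
    then show ?thesis
      using r(1)[OF i(1)] r(1)[OF that] by simp
  qed
  have lim': "((\<lambda>b. eln (emeasure M (ev' b)) / ereal b) \<longlongrightarrow> - ereal (r i)) at_top"
  proof (rule eln_div_tendsto)
    fix \<epsilon> :: real assume "0 < \<epsilon>"
    \<comment> \<open>Since \<open>r i \<le> r j\<close> for all \<open>j\<close>, the union bound
      over the targets only enlarges the constant.\<close>
    have "\<forall>j\<in>{1..J}. \<exists>C. 0 < C \<and> (\<forall>b>0. emeasure M (hits j b) \<le> ennreal (C * exp (- (b * (r j - \<epsilon>)))))"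
      using upper \<open>0 < \<epsilon>\<close> by blast
    from bchoice[OF this] obtain C where C: "\<And>j. j \<in> {1..J} \<Longrightarrow> 0 < C j"
        "\<And>j b. j \<in> {1..J} \<Longrightarrow> 0 < b \<Longrightarrow> emeasure M (hits j b) \<le> ennreal (C j * exp (- (b * (r j - \<epsilon>))))"
      by blast
    have "emeasure M (ev' b) \<le> ennreal ((\<Sum>j=1..J. C j) * exp (- (b * (r i - \<epsilon>))))" if b: "0 < b" for b
    proof -
      have "ev' b \<subseteq> (\<Union>j\<in>{1..J}. hits j b)"
        unfolding ev'_def first_hit_less_iff[OF assms(3)] using hit_mem by blast
      then have "emeasure M (ev' b) \<le> emeasure M (\<Union>j\<in>{1..J}. hits j b)"
        using hits_sets b by (intro emeasure_mono sets.finite_UN) auto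
      also have "\<dots> \<le> (\<Sum>j=1..J. emeasure M (hits j b))"
        using hits_sets b by (intro emeasure_subadditive_finite) auto
      also have "\<dots> \<le> (\<Sum>j=1..J. ennreal (C j * exp (- (b * (r i - \<epsilon>)))))"
      proof (intro sum_mono)
        fix j assume j: "j \<in> {1..J}"
        have "ennreal (C j * exp (- (b * (r j - \<epsilon>)))) \<le> ennreal (C j * exp (- (b * (r i - \<epsilon>))))"
          using i_le[OF j] C(1)[OF j] b by (intro ennreal_leI mult_left_mono) auto
        then show "emeasure M (hits j b) \<le> ennreal (C j * exp (- (b * (r i - \<epsilon>))))"
          using C(2)[OF j b] by (rule order_trans[rotated])
      qed
      also have "\<dots> = ennreal ((\<Sum>j=1..J. C j) * exp (- (b * (r i - \<epsilon>))))"
        using C(1) by (subst sum_ennreal) (auto simp: sum_distrib_right less_imp_le)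
      finally show ?thesis .
    qed
    moreover have "0 < (\<Sum>j=1..J. C j)"
      using C(1) i(1) by (intro sum_pos) auto
    ultimately show "\<exists>C>0. \<forall>\<^sub>F b in at_top. emeasure M (ev' b) \<le> ennreal (C * exp (- (b * (r i - \<epsilon>))))"
      by (intro exI[of _ "\<Sum>j=1..J. C j"]) (auto intro: eventually_mono[OF eventually_gt_at_top[of 0]])
    \<comment> \<open>Reaching the minimising target \<open>i\<close> first already accounts for the
      full exponential rate.\<close>
    have "\<forall>\<^sub>F b in at_top. ennreal (1 / 2 * exp (- (b * (r i + \<epsilon>)))) \<le> emeasure M (ev' b)"
      using lower[OF i(1) \<open>0 < \<epsilon>\<close>] eventually_gt_at_top[of 0]
    proof eventually_elim
      case (elim b)
      have "emeasure M (ev i b) \<le> emeasure M (ev' b)"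
        using first_hit_sets(1)[OF elim(2) assms(3) op i(1)] unfolding ev_def ev'_def by (intro emeasure_mono) auto
      then show ?case
        using elim(1) by (rule order_trans[rotated])
    qed
    then show "\<exists>C>0. \<forall>\<^sub>F b in at_top. ennreal (C * exp (- (b * (r i + \<epsilon>)))) \<le> emeasure M (ev' b)"
      by (intro exI[of _ "1 / 2"]) simp
  qed
  show ?thesis
    using lim lim' finite_rate unfolding ev_def ev'_def i(2) r(1)[OF i(1)] by blast
qed

end
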